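(* Let $k$ be a field and let $A$ be a gentle $k$-algebra associated to $Q$, a finite connected quiver without oriented cycles. Then $A$ has finite Frobenius dimension.
   Context: Path algebra conventions: $kQ$ has as basis all paths of $Q$ including trivial paths; paths are composed left to right, and the product of two paths is their concatenation if possible and $0$ otherwise. $R_Q$ is the ideal generated by the arrows; $I$ is admissible if $R_Q^m\subseteq I\subseteq R_Q^2$ for some $m\ge2$. A finite dimensional $k$-algebra $A$ is gentle if it is Morita equivalent to an algebra $kQ/I$ where $Q$ is a quiver and $I\subset kQ$ is an admissible ideal such that: (1) at each vertex of $Q$ at most 2 arrows start and at most 2 arrows finish; (2) for each arrow $\beta$ there is at most one arrow $\gamma$ with $\beta\gamma$ a path not contained in $I$, and at most one arrow $\alpha$ with $\alpha\beta$ a path not contained in $I$; (3) $I$ is generated by paths of length 2; (4) for each arrow $\beta$ there is at most one arrow $\gamma'$ with $\beta\gamma'$ a path contained in $I$, and at most one arrow $\alpha'$ with $\alpha'\beta$ a path contained in $I$. The gentle algebra is associated to $Q$ when $Q$ is the quiver in this presentation. A nearly Frobenius coproduct on a $k$-algebra $A$ with multiplication $m$ is a $k$-linear map $\Delta:A\to A\otimes_k A$ such that $(\Delta\otimes 1)\circ\Delta=(1\otimes\Delta)\circ\Delta$ and $\Delta\circ m=(1\otimes m)\circ(\Delta\otimes 1)=(m\otimes 1)\circ(1\otimes\Delta)$. The set of all such $\Delta$ is a $k$-vector space $\mathcal{E}$, the Frobenius space of $A$, and the Frobenius dimension is $\operatorname{Frobdim}(A)=\dim_k\mathcal{E}$.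 *)

theory Defs
  imports
    "HOL-Library.Extended_Nat" "Graph_Theory.Graph_Theory"
    "HOL-Algebra.QuotRing" "HOL-Algebra.Ideal_Product" "HOL-Algebra.Module"
begin

section \<open>Linear algebra over a field K\<close>

text \<open>Vector spaces are rendered by the HOL-Algebra locale \<^locale>\<open>module\<close>. The fields
  \<^const>\<open>mult\<close> and \<^const>\<open>one\<close> of the record are irrelevant unless the space is an algebra, and
  are left undefined in that case.\<close>

text \<open>Not necessarily commutative, in contrast to \<^locale>\<open>algebra\<close>.\<close>

locale k_algebra = R?: field R + M?: ring M + module R M
  for R (structure) and M (structure) +
  assumes smult_mult_left: "\<lbrakk>c \<in> carrier R; x \<in> carrier M; y \<in> carrier M\<rbrakk> \<Longrightarrow>
      (c \<odot>\<^bsub>M\<^esub> x) \<otimes>\<^bsub>M\<^esub> y = c \<odot>\<^bsub>M\<^esub> (x \<otimes>\<^bsub>M\<^esub> y)"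
    and smult_mult_right: "\<lbrakk>c \<in> carrier R; x \<in> carrier M; y \<in> carrier M\<rbrakk> \<Longrightarrow>
      x \<otimes>\<^bsub>M\<^esub> (c \<odot>\<^bsub>M\<^esub> y) = c \<odot>\<^bsub>M\<^esub> (x \<otimes>\<^bsub>M\<^esub> y)"

definition lin_span :: "('k, 'r) ring_scheme \<Rightarrow> ('k, 'v, 'm) module_scheme \<Rightarrow> 'v set \<Rightarrow> 'v set"
  where "lin_span K V S = \<Inter>{N. submodule N K V \<and> S \<subseteq> N}"

definition lin_indep :: "('k, 'r) ring_scheme \<Rightarrow> ('k, 'v, 'm) module_scheme \<Rightarrow> 'v set \<Rightarrow> bool"
  where "lin_indep K V B \<longleftrightarrow>
    (\<forall>F c. finite F \<and> F \<subseteq> B \<and> c \<in> F \<rightarrow> carrier K \<and> (\<Oplus>\<^bsub>V\<^esub>x\<in>F. c x \<odot>\<^bsub>V\<^esub> x) = \<zero>\<^bsub>V\<^esub>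
      \<longrightarrow> (\<forall>x\<in>F. c x = \<zero>\<^bsub>K\<^esub>))"

definition is_basis :: "('k, 'r) ring_scheme \<Rightarrow> ('k, 'v, 'm) module_scheme \<Rightarrow> 'v set \<Rightarrow> bool"
  where "is_basis K V B \<longleftrightarrow>
    B \<subseteq> carrier V \<and> lin_indep K V B \<and> lin_span K V B = carrier V"

definition vdim :: "('k, 'r) ring_scheme \<Rightarrow> ('k, 'v, 'm) module_scheme \<Rightarrow> enat"
  where "vdim K V =
    (if \<exists>B. finite B \<and> is_basis K V B
     then enat (card (SOME B. finite B \<and> is_basis K V B)) else \<infinity>)"

text \<open>Maps are extensional (\<^const>\<open>undefined\<close> off the carrier), so that equality of maps is
  equality of functions.\<close>

definition lin_hom :: "('k, 'r) ring_scheme \<Rightarrow> ('k, 'v, 'm) module_scheme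
    \<Rightarrow> ('k, 'w, 'n) module_scheme \<Rightarrow> ('v \<Rightarrow> 'w) set"
  where "lin_hom K V W = {f \<in> carrier V \<rightarrow>\<^sub>E carrier W.
    (\<forall>x\<in>carrier V. \<forall>y\<in>carrier V. f (x \<oplus>\<^bsub>V\<^esub> y) = f x \<oplus>\<^bsub>W\<^esub> f y) \<and>
    (\<forall>c\<in>carrier K. \<forall>x\<in>carrier V. f (c \<odot>\<^bsub>V\<^esub> x) = c \<odot>\<^bsub>W\<^esub> f x)}"

definition hom_space :: "('k, 'r) ring_scheme \<Rightarrow> ('k, 'v, 'm) module_scheme
    \<Rightarrow> ('k, 'w, 'n) module_scheme \<Rightarrow> ('k, 'v \<Rightarrow> 'w) module"
  where "hom_space K V W =
    \<lparr>carrier = lin_hom K V W, mult = undefined, one = undefined,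
     zero = (\<lambda>x\<in>carrier V. \<zero>\<^bsub>W\<^esub>),
     add = (\<lambda>f g. \<lambda>x\<in>carrier V. f x \<oplus>\<^bsub>W\<^esub> g x),
     smult = (\<lambda>c f. \<lambda>x\<in>carrier V. c \<odot>\<^bsub>W\<^esub> f x)\<rparr>"

text \<open>Finitely supported functions on \<open>X\<close>, extended by zero to the whole type.\<close>

definition free_module :: "('k, 'r) ring_scheme \<Rightarrow> 'x set \<Rightarrow> ('k, 'x \<Rightarrow> 'k) module"
  where "free_module K X =
    \<lparr>carrier = {f. (\<forall>x\<in>X. f x \<in> carrier K) \<and> (\<forall>x. x \<notin> X \<longrightarrow> f x = \<zero>\<^bsub>K\<^esub>) \<and>
        finite {x. f x \<noteq> \<zero>\<^bsub>K\<^esub>}},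
     mult = undefined, one = undefined,
     zero = (\<lambda>x. \<zero>\<^bsub>K\<^esub>),
     add = (\<lambda>f g x. f x \<oplus>\<^bsub>K\<^esub> g x),
     smult = (\<lambda>c f x. c \<otimes>\<^bsub>K\<^esub> f x)\<rparr>"

definition free_gen :: "('k, 'r) ring_scheme \<Rightarrow> 'x \<Rightarrow> 'x \<Rightarrow> 'k"
  where "free_gen K x = (\<lambda>y. if y = x then \<one>\<^bsub>K\<^esub> else \<zero>\<^bsub>K\<^esub>)"

text \<open>For a submodule \<open>N\<close> this is the quotient space; if \<open>M\<close> is an algebra and \<open>N\<close> a two-sided
  ideal, it is the quotient algebra.\<close>

definition quotient_module :: "('k, 'v, 'm) module_scheme \<Rightarrow> 'v set \<Rightarrow> ('k, 'v set) module"
  where "quotient_module M N = ring.extend (M Quot N)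
    (module.fields (\<lambda>c X. \<Union>x\<in>X. N +>\<^bsub>M\<^esub> (c \<odot>\<^bsub>M\<^esub> x)))"


section \<open>Tensor products\<close>

type_synonym ('k, 'v, 'w) tensor = "('v \<times> 'w \<Rightarrow> 'k) set"

definition tensor_relators :: "('k, 'r) ring_scheme \<Rightarrow> ('k, 'v, 'm) module_scheme
    \<Rightarrow> ('k, 'w, 'n) module_scheme \<Rightarrow> ('v \<times> 'w \<Rightarrow> 'k) set"
  where "tensor_relators K V W =
    (let F = free_module K (carrier V \<times> carrier W); g = (\<lambda>v w. free_gen K (v, w)) in
      {g (v \<oplus>\<^bsub>V\<^esub> v') w \<ominus>\<^bsub>F\<^esub> (g v w \<oplus>\<^bsub>F\<^esub> g v' w) | v v' w.
         v \<in> carrier V \<and> v' \<in> carrier V \<and> w \<in> carrier W} \<union>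
      {g v (w \<oplus>\<^bsub>W\<^esub> w') \<ominus>\<^bsub>F\<^esub> (g v w \<oplus>\<^bsub>F\<^esub> g v w') | v w w'.
         v \<in> carrier V \<and> w \<in> carrier W \<and> w' \<in> carrier W} \<union>
      {g (c \<odot>\<^bsub>V\<^esub> v) w \<ominus>\<^bsub>F\<^esub> (c \<odot>\<^bsub>F\<^esub> g v w) | c v w.
         c \<in> carrier K \<and> v \<in> carrier V \<and> w \<in> carrier W} \<union>
      {g v (c \<odot>\<^bsub>W\<^esub> w) \<ominus>\<^bsub>F\<^esub> (c \<odot>\<^bsub>F\<^esub> g v w) | c v w.
         c \<in> carrier K \<and> v \<in> carrier V \<and> w \<in> carrier W})"

definition tensor_kernel :: "('k, 'r) ring_scheme \<Rightarrow> ('k, 'v, 'm) module_scheme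
    \<Rightarrow> ('k, 'w, 'n) module_scheme \<Rightarrow> ('v \<times> 'w \<Rightarrow> 'k) set"
  where "tensor_kernel K V W =
    lin_span K (free_module K (carrier V \<times> carrier W)) (tensor_relators K V W)"

definition tensor_product :: "('k, 'r) ring_scheme \<Rightarrow> ('k, 'v, 'm) module_scheme
    \<Rightarrow> ('k, 'w, 'n) module_scheme \<Rightarrow> ('k, ('k, 'v, 'w) tensor) module"
  where "tensor_product K V W =
    quotient_module (free_module K (carrier V \<times> carrier W)) (tensor_kernel K V W)"

definition pure_tensor :: "('k, 'r) ring_scheme \<Rightarrow> ('k, 'v, 'm) module_scheme
    \<Rightarrow> ('k, 'w, 'n) module_scheme \<Rightarrow> 'v \<Rightarrow> 'w \<Rightarrow> ('k, 'v, 'w) tensor"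
  where "pure_tensor K V W v w =
    tensor_kernel K V W +>\<^bsub>free_module K (carrier V \<times> carrier W)\<^esub> free_gen K (v, w)"

text \<open>The linear map that the universal property of the tensor product attaches to a bilinear
  map \<open>b\<close>; it is used for bilinear \<open>b\<close> only.\<close>

definition tensor_lift :: "('k, 'r) ring_scheme \<Rightarrow> ('k, 'v, 'm) module_scheme
    \<Rightarrow> ('k, 'w, 'n) module_scheme \<Rightarrow> ('k, 'u, 'l) module_scheme
    \<Rightarrow> ('v \<Rightarrow> 'w \<Rightarrow> 'u) \<Rightarrow> ('k, 'v, 'w) tensor \<Rightarrow> 'u"
  where "tensor_lift K V W U b =
    (THE h. h \<in> lin_hom K (tensor_product K V W) U \<and>
      (\<forall>v\<in>carrier V. \<forall>w\<in>carrier W. h (pure_tensor K V W v w) = b v w))"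

text \<open>The map \<open>f \<otimes> g : V \<otimes> W \<rightarrow> V' \<otimes> W'\<close>.\<close>

definition tensor_map :: "('k, 'r) ring_scheme \<Rightarrow> ('k, 'v, 'm) module_scheme
    \<Rightarrow> ('k, 'w, 'n) module_scheme \<Rightarrow> ('k, 'v1, 'm1) module_scheme
    \<Rightarrow> ('k, 'w1, 'n1) module_scheme \<Rightarrow> ('v \<Rightarrow> 'v1) \<Rightarrow> ('w \<Rightarrow> 'w1)
    \<Rightarrow> ('k, 'v, 'w) tensor \<Rightarrow> ('k, 'v1, 'w1) tensor"
  where "tensor_map K V W V' W' f g =
    tensor_lift K V W (tensor_product K V' W') (\<lambda>v w. pure_tensor K V' W' (f v) (g w))"

text \<open>The canonical maps \<open>(U \<otimes> V) \<otimes> W \<rightarrow> U \<otimes> (V \<otimes> W)\<close> and back.\<close>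

definition tensor_assoc :: "('k, 'r) ring_scheme \<Rightarrow> ('k, 'u, 'l) module_scheme
    \<Rightarrow> ('k, 'v, 'm) module_scheme \<Rightarrow> ('k, 'w, 'n) module_scheme
    \<Rightarrow> ('k, ('k, 'u, 'v) tensor, 'w) tensor \<Rightarrow> ('k, 'u, ('k, 'v, 'w) tensor) tensor"
  where "tensor_assoc K U V W =
    (let VW = tensor_product K V W; T = tensor_product K U VW in
      tensor_lift K (tensor_product K U V) W T
        (\<lambda>t w. tensor_lift K U V T (\<lambda>u v. pure_tensor K U VW u (pure_tensor K V W v w)) t))"

definition tensor_assoc_inv :: "('k, 'r) ring_scheme \<Rightarrow> ('k, 'u, 'l) module_scheme
    \<Rightarrow> ('k, 'v, 'm) module_scheme \<Rightarrow> ('k, 'w, 'n) module_scheme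
    \<Rightarrow> ('k, 'u, ('k, 'v, 'w) tensor) tensor \<Rightarrow> ('k, ('k, 'u, 'v) tensor, 'w) tensor"
  where "tensor_assoc_inv K U V W =
    (let UV = tensor_product K U V; T = tensor_product K UV W in
      tensor_lift K U (tensor_product K V W) T
        (\<lambda>u t. tensor_lift K V W T (\<lambda>v w. pure_tensor K UV W (pure_tensor K U V u v) w) t))"


section \<open>Nearly Frobenius coproducts\<close>

definition mult_map :: "('k, 'r) ring_scheme \<Rightarrow> ('k, 'a, 'm) module_scheme
    \<Rightarrow> ('k, 'a, 'a) tensor \<Rightarrow> 'a"
  where "mult_map K A = tensor_lift K A A A (\<lambda>a b. a \<otimes>\<^bsub>A\<^esub> b)"

text \<open>\<open>(A \<otimes> A) \<otimes> A\<close> and \<open>A \<otimes> (A \<otimes> A)\<close> are distinct here, so the identification left implicit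
  on paper is made by \<^const>\<open>tensor_assoc\<close> and \<^const>\<open>tensor_assoc_inv\<close>.\<close>

definition nearly_frobenius_coproduct :: "('k, 'r) ring_scheme \<Rightarrow> ('k, 'a, 'm) module_scheme
    \<Rightarrow> ('a \<Rightarrow> ('k, 'a, 'a) tensor) \<Rightarrow> bool"
  where "nearly_frobenius_coproduct K A \<Delta> \<longleftrightarrow>
    (let AA = tensor_product K A A; m = mult_map K A; i = (\<lambda>a. a) in
      \<Delta> \<in> lin_hom K A AA \<and>
      (\<forall>a\<in>carrier A.
         tensor_assoc K A A A (tensor_map K A A AA A \<Delta> i (\<Delta> a)) =
         tensor_map K A A A AA i \<Delta> (\<Delta> a)) \<and>
      (\<forall>t\<in>carrier AA.
         \<Delta> (m t) = tensor_map K A AA A A i m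
           (tensor_assoc K A A A (tensor_map K A A AA A \<Delta> i t)) \<and>
         \<Delta> (m t) = tensor_map K AA A A A m i
           (tensor_assoc_inv K A A A (tensor_map K A A A AA i \<Delta> t))))"

definition frobenius_space :: "('k, 'r) ring_scheme \<Rightarrow> ('k, 'a, 'm) module_scheme
    \<Rightarrow> ('k, 'a \<Rightarrow> ('k, 'a, 'a) tensor) module"
  where "frobenius_space K A =
    (hom_space K A (tensor_product K A A))
      \<lparr>carrier := {\<Delta>. nearly_frobenius_coproduct K A \<Delta>}\<rparr>"

definition Frobdim :: "('k, 'r) ring_scheme \<Rightarrow> ('k, 'a, 'm) module_scheme \<Rightarrow> enat"
  where "Frobdim K A = vdim K (frobenius_space K A)"


section \<open>Path algebras\<close>

text \<open>A quiver is a \<^locale>\<open>wf_digraph\<close>. A path is given by its source and its list of arrows,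
  read from left to right; the trivial path at \<open>v\<close> is \<open>(v, [])\<close>.\<close>

type_synonym ('v, 'e) path = "'v \<times> 'e list"

definition paths :: "('v, 'e) pre_digraph \<Rightarrow> ('v, 'e) path set"
  where "paths Q = {(u, p). \<exists>v. pre_digraph.awalk Q u p v}"

definition path_target :: "('v, 'e) pre_digraph \<Rightarrow> ('v, 'e) path \<Rightarrow> 'v"
  where "path_target Q x = last (pre_digraph.awalk_verts Q (fst x) (snd x))"

text \<open>The coefficient of a path \<open>z\<close> in \<open>f g\<close> is the sum of \<open>f x * g y\<close> over all ways to write
  \<open>z\<close> as a concatenation \<open>x y\<close>. The unit is the sum of the trivial paths, which lies in the
  carrier only if there are finitely many vertices.\<close>

definition path_algebra :: "('k, 'r) ring_scheme \<Rightarrow> ('v, 'e) pre_digraph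
    \<Rightarrow> ('k, ('v, 'e) path \<Rightarrow> 'k) module"
  where "path_algebra K Q = (free_module K (paths Q))
    \<lparr>mult := (\<lambda>f g z. finsum K (\<lambda>(x, y). f x \<otimes>\<^bsub>K\<^esub> g y)
        {(x, y). x \<in> paths Q \<and> y \<in> paths Q \<and> path_target Q x = fst y \<and>
          z = (fst x, snd x @ snd y)}),
     one := (\<lambda>z. if fst z \<in> verts Q \<and> snd z = [] then \<one>\<^bsub>K\<^esub> else \<zero>\<^bsub>K\<^esub>)\<rparr>"

definition arrow_ideal :: "('k, 'r) ring_scheme \<Rightarrow> ('v, 'e) pre_digraph
    \<Rightarrow> (('v, 'e) path \<Rightarrow> 'k) set"
  where "arrow_ideal K Q =
    Idl\<^bsub>path_algebra K Q\<^esub> {free_gen K (tail Q e, [e]) | e. e \<in> arcs Q}"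

definition admissible :: "('k, 'r) ring_scheme \<Rightarrow> ('v, 'e) pre_digraph
    \<Rightarrow> (('v, 'e) path \<Rightarrow> 'k) set \<Rightarrow> bool"
  where "admissible K Q I \<longleftrightarrow>
    ideal I (path_algebra K Q) \<and>
    (\<exists>m::nat\<ge>2. arrow_ideal K Q [^]\<^bsub>ideals_set (path_algebra K Q)\<^esub> m \<subseteq> I) \<and>
    I \<subseteq> arrow_ideal K Q [^]\<^bsub>ideals_set (path_algebra K Q)\<^esub> (2::nat)"


section \<open>Morita equivalence\<close>

record ('k, 'm, 'a) rmodule = "('k, 'm) module" +
  ract :: "'m \<Rightarrow> 'a \<Rightarrow> 'm"

definition right_module :: "('k, 'r) ring_scheme \<Rightarrow> ('k, 'a, 'z) module_scheme
    \<Rightarrow> ('k, 'm, 'a) rmodule \<Rightarrow> bool"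
  where "right_module K A M \<longleftrightarrow> module K M \<and>
    (\<forall>x\<in>carrier M. \<forall>a\<in>carrier A. ract M x a \<in> carrier M) \<and>
    (\<forall>x\<in>carrier M. \<forall>y\<in>carrier M. \<forall>a\<in>carrier A.
       ract M (x \<oplus>\<^bsub>M\<^esub> y) a = ract M x a \<oplus>\<^bsub>M\<^esub> ract M y a) \<and>
    (\<forall>x\<in>carrier M. \<forall>a\<in>carrier A. \<forall>b\<in>carrier A.
       ract M x (a \<oplus>\<^bsub>A\<^esub> b) = ract M x a \<oplus>\<^bsub>M\<^esub> ract M x b) \<and>
    (\<forall>c\<in>carrier K. \<forall>x\<in>carrier M. \<forall>a\<in>carrier A.
       ract M (c \<odot>\<^bsub>M\<^esub> x) a = c \<odot>\<^bsub>M\<^esub> ract M x a \<and>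
       ract M x (c \<odot>\<^bsub>A\<^esub> a) = c \<odot>\<^bsub>M\<^esub> ract M x a) \<and>
    (\<forall>x\<in>carrier M. \<forall>a\<in>carrier A. \<forall>b\<in>carrier A.
       ract M x (a \<otimes>\<^bsub>A\<^esub> b) = ract M (ract M x a) b) \<and>
    (\<forall>x\<in>carrier M. ract M x \<one>\<^bsub>A\<^esub> = x)"

text \<open>The category of finite dimensional right modules. Carriers range over the subsets of the
  type of sequences in \<open>'k\<close>; this contains every coordinate space, hence an isomorphic copy of
  every finite dimensional module.\<close>

type_synonym ('k, 'a) fd_module = "('k, nat \<Rightarrow> 'k, 'a) rmodule"

definition fd_modules :: "('k, 'r) ring_scheme \<Rightarrow> ('k, 'a, 'z) module_scheme
    \<Rightarrow> ('k, 'a) fd_module set"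
  where "fd_modules K A = {M. right_module K A M \<and> vdim K M \<noteq> \<infinity>}"

definition rmodule_hom :: "('k, 'r) ring_scheme \<Rightarrow> ('k, 'a, 'z) module_scheme
    \<Rightarrow> ('k, 'm, 'a) rmodule \<Rightarrow> ('k, 'n, 'a) rmodule \<Rightarrow> ('m \<Rightarrow> 'n) set"
  where "rmodule_hom K A M N = {f \<in> lin_hom K M N.
    \<forall>x\<in>carrier M. \<forall>a\<in>carrier A. f (ract M x a) = ract N (f x) a}"

text \<open>The action of a functor on a morphism takes source and target as additional arguments,
  since a function does not determine its target.\<close>

type_synonym ('k, 'a, 'b) fobj = "('k, 'a) fd_module \<Rightarrow> ('k, 'b) fd_module"
type_synonym ('k, 'a) fmor = "('k, 'a) fd_module \<Rightarrow> ('k, 'a) fd_module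
    \<Rightarrow> ((nat \<Rightarrow> 'k) \<Rightarrow> nat \<Rightarrow> 'k) \<Rightarrow> (nat \<Rightarrow> 'k) \<Rightarrow> nat \<Rightarrow> 'k"

definition k_linear_functor :: "('k, 'r) ring_scheme \<Rightarrow> ('k, 'a, 'z) module_scheme
    \<Rightarrow> ('k, 'b, 'y) module_scheme \<Rightarrow> ('k, 'a, 'b) fobj \<Rightarrow> ('k, 'a) fmor \<Rightarrow> bool"
  where "k_linear_functor K A B F F1 \<longleftrightarrow>
    (\<forall>M\<in>fd_modules K A. F M \<in> fd_modules K B) \<and>
    (\<forall>M\<in>fd_modules K A. \<forall>N\<in>fd_modules K A.
       F1 M N \<in> rmodule_hom K A M N \<rightarrow> rmodule_hom K B (F M) (F N)) \<and>
    (\<forall>M\<in>fd_modules K A. F1 M M (\<lambda>x\<in>carrier M. x) = (\<lambda>x\<in>carrier (F M). x)) \<and>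
    (\<forall>L\<in>fd_modules K A. \<forall>M\<in>fd_modules K A. \<forall>N\<in>fd_modules K A.
       \<forall>f\<in>rmodule_hom K A L M. \<forall>g\<in>rmodule_hom K A M N.
         F1 L N (compose (carrier L) g f) = compose (carrier (F L)) (F1 M N g) (F1 L M f)) \<and>
    (\<forall>M\<in>fd_modules K A. \<forall>N\<in>fd_modules K A.
       \<forall>f\<in>rmodule_hom K A M N. \<forall>g\<in>rmodule_hom K A M N. \<forall>c\<in>carrier K.
         F1 M N (f \<oplus>\<^bsub>hom_space K M N\<^esub> g) =
           F1 M N f \<oplus>\<^bsub>hom_space K (F M) (F N)\<^esub> F1 M N g \<and>
         F1 M N (c \<odot>\<^bsub>hom_space K M N\<^esub> f) =
           c \<odot>\<^bsub>hom_space K (F M) (F N)\<^esub> F1 M N f)"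

definition natural_iso :: "('k, 'r) ring_scheme \<Rightarrow> ('k, 'a, 'z) module_scheme
    \<Rightarrow> ('k, 'b, 'y) module_scheme \<Rightarrow> ('k, 'a, 'b) fobj \<Rightarrow> ('k, 'a) fmor
    \<Rightarrow> ('k, 'a, 'b) fobj \<Rightarrow> ('k, 'a) fmor
    \<Rightarrow> (('k, 'a) fd_module \<Rightarrow> (nat \<Rightarrow> 'k) \<Rightarrow> nat \<Rightarrow> 'k) \<Rightarrow> bool"
  where "natural_iso K A B F F1 G G1 \<eta> \<longleftrightarrow>
    (\<forall>M\<in>fd_modules K A. \<eta> M \<in> rmodule_hom K B (F M) (G M) \<and>
       bij_betw (\<eta> M) (carrier (F M)) (carrier (G M))) \<and>
    (\<forall>M\<in>fd_modules K A. \<forall>N\<in>fd_modules K A. \<forall>f\<in>rmodule_hom K A M N.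
       compose (carrier (F M)) (\<eta> N) (F1 M N f) = compose (carrier (F M)) (G1 M N f) (\<eta> M))"

definition morita_equivalent :: "('k, 'r) ring_scheme \<Rightarrow> ('k, 'a, 'z) module_scheme
    \<Rightarrow> ('k, 'b, 'y) module_scheme \<Rightarrow> bool"
  where "morita_equivalent K A B \<longleftrightarrow>
    (\<exists>F F1 G G1 \<eta> \<epsilon>.
       k_linear_functor K A B F F1 \<and> k_linear_functor K B A G G1 \<and>
       natural_iso K A A (\<lambda>M. G (F M)) (\<lambda>M N f. G1 (F M) (F N) (F1 M N f))
         (\<lambda>M. M) (\<lambda>M N f. f) \<eta> \<and>
       natural_iso K B B (\<lambda>M. F (G M)) (\<lambda>M N f. F1 (G M) (G N) (G1 M N f))
         (\<lambda>M. M) (\<lambda>M N f. f) \<epsilon>)"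


section \<open>Gentle algebras\<close>

text \<open>For composable arrows \<open>a\<close> and \<open>b\<close>, the path \<open>ab\<close> as an element of the path algebra.\<close>

definition arrow_pair :: "('k, 'r) ring_scheme \<Rightarrow> ('v, 'e) pre_digraph \<Rightarrow> 'e \<Rightarrow> 'e
    \<Rightarrow> ('v, 'e) path \<Rightarrow> 'k"
  where "arrow_pair K Q a b = free_gen K (tail Q a, [a, b])"

definition composable :: "('v, 'e) pre_digraph \<Rightarrow> 'e \<Rightarrow> 'e \<Rightarrow> bool"
  where "composable Q a b \<longleftrightarrow> a \<in> arcs Q \<and> b \<in> arcs Q \<and> head Q a = tail Q b"

definition gentle_presentation :: "('k, 'r) ring_scheme \<Rightarrow> ('v, 'e) pre_digraph
    \<Rightarrow> (('v, 'e) path \<Rightarrow> 'k) set \<Rightarrow> bool"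
  where "gentle_presentation K Q I \<longleftrightarrow>
    fin_digraph Q \<and> admissible K Q I \<and>
    (\<forall>v\<in>verts Q. out_degree Q v \<le> 2 \<and> in_degree Q v \<le> 2) \<and>
    (\<forall>b\<in>arcs Q. (\<exists>\<^sub>\<le>\<^sub>1 c. composable Q b c \<and> arrow_pair K Q b c \<notin> I) \<and>
                (\<exists>\<^sub>\<le>\<^sub>1 a. composable Q a b \<and> arrow_pair K Q a b \<notin> I)) \<and>
    (\<exists>S. S \<subseteq> {arrow_pair K Q a b | a b. composable Q a b} \<and>
         I = Idl\<^bsub>path_algebra K Q\<^esub> S) \<and>
    (\<forall>b\<in>arcs Q. (\<exists>\<^sub>\<le>\<^sub>1 c. composable Q b c \<and> arrow_pair K Q b c \<in> I) \<and>
                (\<exists>\<^sub>\<le>\<^sub>1 a. composable Q a b \<and> arrow_pair K Q a b \<in> I))"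

definition gentle_algebra :: "('k, 'r) ring_scheme \<Rightarrow> ('k, 'a, 'm) module_scheme
    \<Rightarrow> ('v, 'e) pre_digraph \<Rightarrow> bool"
  where "gentle_algebra K A Q \<longleftrightarrow>
    k_algebra K A \<and> vdim K A \<noteq> \<infinity> \<and>
    (\<exists>I. gentle_presentation K Q I \<and>
         morita_equivalent K A (quotient_module (path_algebra K Q) I))"

end

theory Submission
  imports Defs
begin

text \<open>A gentle algebra \<open>A\<close> is finite dimensional, so it suffices to embed the space of its nearly
Frobenius coproducts linearly into the finite dimensional space \<open>A \<otimes> A\<close>. The embedding is
\<open>\<Delta> \<mapsto> \<Delta> 1\<close>.

The compatibility of \<open>\<Delta>\<close> with the multiplication says that \<open>\<Delta>\<close> is a map of bimodules,
\<open>\<Delta> (a b) = (\<Delta> a) b = a (\<Delta> b)\<close>, where \<open>A\<close> acts on \<open>A \<otimes> A\<close> by \<open>a (x \<otimes> y) = a x \<otimes> y\<close> and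
\<open>(x \<otimes> y) b = x \<otimes> y b\<close>. In particular \<open>\<Delta> a = a (\<Delta> 1)\<close>, which is why \<open>\<Delta> \<mapsto> \<Delta> 1\<close> is injective.

That the coproducts form a vector space at all is not visible from their definition, since
coassociativity is quadratic in \<open>\<Delta>\<close>. It holds because coassociativity is a consequence of the
bimodule property (\<open>coassociative_if_bimodule_map\<close>), and the latter is linear in \<open>\<Delta>\<close>. To see this,
consider the bilinear map \<open>G\<close> with \<open>G (p \<otimes> q) (x \<otimes> y) = p \<otimes> (q x \<otimes> y)\<close>. Since
\<open>\<Delta> x = (\<Delta> 1) x\<close>, one has \<open>(\<Delta> \<otimes> 1) v = G (\<Delta> 1) v\<close> for all \<open>v\<close>. Since
\<open>q (\<Delta> a) = \<Delta> (q a)\<close>, one also has \<open>G u (\<Delta> a) = (1 \<otimes> \<Delta>) (u a)\<close> for all \<open>u\<close>. For \<open>v = \<Delta> a\<close> and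
\<open>u = \<Delta> 1\<close> the two right-hand sides are equal, because \<open>(\<Delta> 1) a = \<Delta> a\<close>.

The rest is foundational: subspaces of finitely spanned spaces are finitely spanned
(\<open>finitely_spanned_if_injective\<close>), finitely spanned spaces have finite bases, and tensor products
have their universal property (\<open>tensor_lift_universal\<close>), which makes two linear maps on
\<open>V \<otimes> W\<close> equal as soon as they agree on pure tensors (\<open>tensor_ext\<close>).\<close>

section \<open>Linear maps, spans and finite bases\<close>

text \<open>Unlike membership in \<^const>\<open>lin_hom\<close>, this ignores the values off the carrier. Linear maps in this
sense are closed under composition by plain \<open>\<lambda>\<close>-terms.\<close>

definition linear_map :: "('k, 'r) ring_scheme \<Rightarrow> ('k, 'v, 'm) module_scheme
    \<Rightarrow> ('k, 'w, 'n) module_scheme \<Rightarrow> ('v \<Rightarrow> 'w) \<Rightarrow> bool"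
  where "linear_map K V W f \<longleftrightarrow> f \<in> carrier V \<rightarrow> carrier W \<and>
    (\<forall>x\<in>carrier V. \<forall>y\<in>carrier V. f (x \<oplus>\<^bsub>V\<^esub> y) = f x \<oplus>\<^bsub>W\<^esub> f y) \<and>
    (\<forall>c\<in>carrier K. \<forall>x\<in>carrier V. f (c \<odot>\<^bsub>V\<^esub> x) = c \<odot>\<^bsub>W\<^esub> f x)"

lemma linear_mapI:
  assumes "\<And>x. x \<in> carrier V \<Longrightarrow> f x \<in> carrier W"
    and "\<And>x y. x \<in> carrier V \<Longrightarrow> y \<in> carrier V \<Longrightarrow> f (x \<oplus>\<^bsub>V\<^esub> y) = f x \<oplus>\<^bsub>W\<^esub> f y"
    and "\<And>c x. c \<in> carrier K \<Longrightarrow> x \<in> carrier V \<Longrightarrow> f (c \<odot>\<^bsub>V\<^esub> x) = c \<odot>\<^bsub>W\<^esub> f x"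
  shows "linear_map K V W f"
  using assms by (auto simp: linear_map_def)

lemma linear_map_closed: "linear_map K V W f \<Longrightarrow> x \<in> carrier V \<Longrightarrow> f x \<in> carrier W"
  by (auto simp: linear_map_def)

lemma linear_map_add: "linear_map K V W f \<Longrightarrow> x \<in> carrier V \<Longrightarrow> y \<in> carrier V
    \<Longrightarrow> f (x \<oplus>\<^bsub>V\<^esub> y) = f x \<oplus>\<^bsub>W\<^esub> f y"
  by (auto simp: linear_map_def)

lemma linear_map_smult: "linear_map K V W f \<Longrightarrow> c \<in> carrier K \<Longrightarrow> x \<in> carrier V
    \<Longrightarrow> f (c \<odot>\<^bsub>V\<^esub> x) = c \<odot>\<^bsub>W\<^esub> f x"
  by (auto simp: linear_map_def)

lemma linear_map_if_lin_hom: "f \<in> lin_hom K V W \<Longrightarrow> linear_map K V W f"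
  by (auto simp: linear_map_def lin_hom_def)

lemma linear_map_compose:
  assumes "linear_map K V W f" "linear_map K U V g"
  shows "linear_map K U W (\<lambda>x. f (g x))"
  using assms by (auto simp: linear_map_def Pi_def)

lemma linear_map_id: "linear_map K V V (\<lambda>x. x)"
  by (auto simp: linear_map_def)

lemma linear_map_zero:
  assumes "module K V" "module K W" "linear_map K V W f"
  shows "f \<zero>\<^bsub>V\<^esub> = \<zero>\<^bsub>W\<^esub>"
proof -
  interpret V: module K V by fact
  interpret W: module K W by fact
  have "f (\<zero>\<^bsub>K\<^esub> \<odot>\<^bsub>V\<^esub> \<zero>\<^bsub>V\<^esub>) = \<zero>\<^bsub>K\<^esub> \<odot>\<^bsub>W\<^esub> f \<zero>\<^bsub>V\<^esub>"
    using linear_map_smult[OF assms(3)] by blast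
  then show ?thesis
    using linear_map_closed[OF assms(3) V.zero_closed] by simp
qed

lemma a_inv_eq_smult:
  assumes "module K V" "x \<in> carrier V"
  shows "\<ominus>\<^bsub>V\<^esub> x = (\<ominus>\<^bsub>K\<^esub> \<one>\<^bsub>K\<^esub>) \<odot>\<^bsub>V\<^esub> x"
proof -
  interpret V: module K V by fact
  show ?thesis using assms V.smult_l_minus by simp
qed

lemma linear_map_a_inv:
  assumes "module K V" "module K W" "linear_map K V W f" "x \<in> carrier V"
  shows "f (\<ominus>\<^bsub>V\<^esub> x) = \<ominus>\<^bsub>W\<^esub> f x"
proof -
  interpret V: module K V by fact
  show ?thesis
    using assms by (simp add: a_inv_eq_smult linear_map_smult linear_map_closed)
qed

lemma linear_map_minus:
  assumes "module K V" "module K W" "linear_map K V W f" "x \<in> carrier V" "y \<in> carrier V"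
  shows "f (x \<ominus>\<^bsub>V\<^esub> y) = f x \<ominus>\<^bsub>W\<^esub> f y"
proof -
  interpret V: module K V by fact
  show ?thesis
    using assms by (simp add: a_minus_def linear_map_add linear_map_a_inv)
qed

lemma submodule_if_closed:
  assumes "module K V" "N \<subseteq> carrier V" "\<zero>\<^bsub>V\<^esub> \<in> N"
    and "\<And>x y. x \<in> N \<Longrightarrow> y \<in> N \<Longrightarrow> x \<oplus>\<^bsub>V\<^esub> y \<in> N"
    and "\<And>c x. c \<in> carrier K \<Longrightarrow> x \<in> N \<Longrightarrow> c \<odot>\<^bsub>V\<^esub> x \<in> N"
  shows "submodule N K V"
proof -
  interpret V: module K V by fact
  show ?thesis
    using assms by (intro V.submoduleI) (auto simp: a_inv_eq_smult subset_iff)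
qed

lemma submodule_vimage:
  assumes "module K V" "module K W" "linear_map K V W f" "submodule N K W"
  shows "submodule {x \<in> carrier V. f x \<in> N} K V"
proof -
  interpret V: module K V by fact
  interpret W: module K W by fact
  note N = W.submoduleE[OF assms(4)]
  have "\<zero>\<^bsub>W\<^esub> \<in> N"
    using submodule.axioms(1)[OF assms(4)] subgroup.one_closed by fastforce
  then show ?thesis
    using N assms(3) linear_map_zero[OF assms(1-3)]
    by (intro submodule_if_closed[OF assms(1)]) (auto simp: linear_map_add linear_map_smult)
qed

lemma submodule_equalizer:
  assumes "module K V" "module K W" "linear_map K V W f" "linear_map K V W g"
  shows "submodule {x \<in> carrier V. f x = g x} K V"
proof -
  interpret V: module K V by fact
  show ?thesis
    using assms linear_map_zero[OF assms(1-3)] linear_map_zero[OF assms(1,2,4)]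
    by (intro submodule_if_closed[OF assms(1)]) (auto simp: linear_map_add linear_map_smult)
qed

lemma submodule_zero_singleton:
  assumes "module K V" shows "submodule {\<zero>\<^bsub>V\<^esub>} K V"
proof -
  interpret V: module K V by fact
  show ?thesis by (intro submodule_if_closed[OF assms]) auto
qed

lemma lin_span_least: "submodule N K V \<Longrightarrow> S \<subseteq> N \<Longrightarrow> lin_span K V S \<subseteq> N"
  by (auto simp: lin_span_def)

lemma lin_span_superset: "S \<subseteq> lin_span K V S"
  by (auto simp: lin_span_def)

lemma lin_span_subset_carrier:
  assumes "module K V" "S \<subseteq> carrier V"
  shows "lin_span K V S \<subseteq> carrier V"
  using lin_span_least[OF module.carrier_is_submodule[OF assms(1)] assms(2)] .

lemma submodule_lin_span:
  assumes "module K V" "S \<subseteq> carrier V"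
  shows "submodule (lin_span K V S) K V"
proof (rule submodule_if_closed[OF assms(1) lin_span_subset_carrier[OF assms]])
  interpret V: module K V by fact
  show "\<zero>\<^bsub>V\<^esub> \<in> lin_span K V S"
    using subgroup.one_closed[OF submodule.axioms(1)] by (fastforce simp: lin_span_def)
qed (use module.submoduleE[OF assms(1)] in \<open>auto simp: lin_span_def\<close>)

lemma lin_span_zero:
  assumes "module K V" "S \<subseteq> carrier V"
  shows "\<zero>\<^bsub>V\<^esub> \<in> lin_span K V S"
  using subgroup.one_closed[OF submodule.axioms(1)[OF submodule_lin_span[OF assms]]] by simp

lemma lin_span_mono: "S \<subseteq> T \<Longrightarrow> lin_span K V S \<subseteq> lin_span K V T"
  by (auto simp: lin_span_def)

text \<open>The form that spanned elements take is obtained without writing linear combinations: the elements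
of this form are a submodule, and the span is the least one.\<close>

lemma lin_span_insertE:
  assumes "module K V" "S \<subseteq> carrier V" "s \<in> carrier V" "x \<in> lin_span K V (insert s S)"
  obtains c w where "c \<in> carrier K" "w \<in> lin_span K V S" "x = c \<odot>\<^bsub>V\<^esub> s \<oplus>\<^bsub>V\<^esub> w"
proof -
  interpret V: module K V by fact
  let ?L = "lin_span K V S"
  let ?N = "{c \<odot>\<^bsub>V\<^esub> s \<oplus>\<^bsub>V\<^esub> w | c w. c \<in> carrier K \<and> w \<in> ?L}"
  note L = V.submoduleE[OF submodule_lin_span[OF assms(1,2)]] lin_span_zero[OF assms(1,2)]
  have L': "w \<in> carrier V" if "w \<in> ?L" for w using that L by blast
  have "submodule ?N K V"
  proof (rule submodule_if_closed[OF assms(1)])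
    show "?N \<subseteq> carrier V" using L' assms(3) by auto
    show "\<zero>\<^bsub>V\<^esub> \<in> ?N"
      using L' L assms(3) by (intro CollectI exI[of _ "\<zero>\<^bsub>K\<^esub>"] exI[of _ "\<zero>\<^bsub>V\<^esub>"]) auto
  next
    fix x y assume "x \<in> ?N" "y \<in> ?N"
    then obtain c w d w' where *: "c \<in> carrier K" "w \<in> ?L" "x = c \<odot>\<^bsub>V\<^esub> s \<oplus>\<^bsub>V\<^esub> w"
      "d \<in> carrier K" "w' \<in> ?L" "y = d \<odot>\<^bsub>V\<^esub> s \<oplus>\<^bsub>V\<^esub> w'" by blast
    then have "x \<oplus>\<^bsub>V\<^esub> y = (c \<oplus>\<^bsub>K\<^esub> d) \<odot>\<^bsub>V\<^esub> s \<oplus>\<^bsub>V\<^esub> (w \<oplus>\<^bsub>V\<^esub> w')"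
      using L' assms(3) by (simp add: V.smult_l_distr V.add.m_ac)
    then show "x \<oplus>\<^bsub>V\<^esub> y \<in> ?N" using * L by blast
  next
    fix a x assume a: "a \<in> carrier K" and "x \<in> ?N"
    then obtain c w where *: "c \<in> carrier K" "w \<in> ?L" "x = c \<odot>\<^bsub>V\<^esub> s \<oplus>\<^bsub>V\<^esub> w" by blast
    then have "a \<odot>\<^bsub>V\<^esub> x = (a \<otimes>\<^bsub>K\<^esub> c) \<odot>\<^bsub>V\<^esub> s \<oplus>\<^bsub>V\<^esub> (a \<odot>\<^bsub>V\<^esub> w)"
      using L' assms(3) a by (simp add: V.smult_r_distr V.smult_assoc1)
    then show "a \<odot>\<^bsub>V\<^esub> x \<in> ?N" using * L a by blast
  qed
  moreover have "insert s S \<subseteq> ?N"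
  proof (intro subsetI)
    fix t assume "t \<in> insert s S"
    then consider "t = s" | "t \<in> S" by blast
    then show "t \<in> ?N"
    proof cases
      case 1
      then have "t = \<one>\<^bsub>K\<^esub> \<odot>\<^bsub>V\<^esub> s \<oplus>\<^bsub>V\<^esub> \<zero>\<^bsub>V\<^esub>" using assms(3) by simp
      then show ?thesis using L by blast
    next
      case 2
      then have "t = \<zero>\<^bsub>K\<^esub> \<odot>\<^bsub>V\<^esub> s \<oplus>\<^bsub>V\<^esub> t" using assms(2,3) by auto
      then show ?thesis using 2 lin_span_superset[of S K V] by blast
    qed
  qed
  ultimately have "x \<in> ?N" using lin_span_least assms(4) by blast
  then show thesis using that by blast
qed

text \<open>Vector spaces are noetherian, in a form that also covers subspaces of \<open>V\<close> and injective maps into a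
larger space. The induction removes one generator \<open>s\<close> at a time. Either all of \<open>N\<close> is mapped into
the span of the remaining generators, or some \<open>n \<in> N\<close> has an image with a nonzero coefficient at
\<open>s\<close>; then a multiple of \<open>n\<close> can be subtracted from any element of \<open>N\<close> so that this coefficient
vanishes, and one more generator suffices for \<open>N\<close>.\<close>

lemma finitely_spanned_if_injective:
  assumes "field K" "module K V" "module K W" "linear_map K V W f"
    and inj: "\<And>x. x \<in> carrier V \<Longrightarrow> f x = \<zero>\<^bsub>W\<^esub> \<Longrightarrow> x = \<zero>\<^bsub>V\<^esub>"
    and "finite S" "S \<subseteq> carrier W" "submodule N K V" "f ` N \<subseteq> lin_span K W S"
  shows "\<exists>F. finite F \<and> F \<subseteq> N \<and> N \<subseteq> lin_span K V F"
  using assms(6-)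
proof (induction S arbitrary: N rule: finite_induct)
  case empty
  have "lin_span K W {} \<subseteq> {\<zero>\<^bsub>W\<^esub>}"
    by (intro lin_span_least submodule_zero_singleton assms) auto
  moreover have "N \<subseteq> carrier V"
    using module.submoduleE(1)[OF assms(2) empty(2)] .
  ultimately have "N \<subseteq> {\<zero>\<^bsub>V\<^esub>}" using empty inj by blast
  then have "N \<subseteq> lin_span K V {}" using lin_span_zero[OF assms(2)] by blast
  then show ?case by blast
next
  case (insert s S)
  interpret K: field K by fact
  interpret V: module K V by fact
  interpret W: module K W by fact
  have S: "S \<subseteq> carrier W" "s \<in> carrier W" using insert by auto
  note N = V.submoduleE[OF insert.prems(2)]
  note L = W.submoduleE[OF submodule_lin_span[OF assms(3) S(1)]]
  define N' where "N' = N \<inter> {x \<in> carrier V. f x \<in> lin_span K W S}"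
  have "submodule {x \<in> carrier V. f x \<in> lin_span K W S} K V"
    by (intro submodule_vimage[OF assms(2,3,4)] submodule_lin_span S assms)
  note M = V.submoduleE[OF this]
  have zM: "\<zero>\<^bsub>V\<^esub> \<in> N'"
    using subgroup.one_closed[OF submodule.axioms(1)[OF insert.prems(2)]]
      lin_span_zero[OF assms(3) S(1)] linear_map_zero[OF assms(2,3,4)]
    by (simp add: N'_def)
  have N': "submodule N' K V"
  proof (rule submodule_if_closed[OF assms(2) _ zM])
    show "N' \<subseteq> carrier V" by (auto simp: N'_def)
    show "x \<oplus>\<^bsub>V\<^esub> y \<in> N'" if "x \<in> N'" "y \<in> N'" for x y
      using that N(5) M(5) unfolding N'_def by blast
    show "c \<odot>\<^bsub>V\<^esub> x \<in> N'" if "c \<in> carrier K" "x \<in> N'" for c x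
      using that N(4) M(4) unfolding N'_def by blast
  qed
  have "f ` N' \<subseteq> lin_span K W S" by (auto simp: N'_def)
  then obtain F where F: "finite F" "F \<subseteq> N'" "N' \<subseteq> lin_span K V F"
    using insert.IH[OF S(1) N'] by blast
  show ?case
  proof (cases "N \<subseteq> N'")
    case True
    then show ?thesis using F by (auto simp: N'_def)
  next
    case False
    then obtain n where n: "n \<in> N" "n \<notin> N'" by blast
    obtain c w where cw: "c \<in> carrier K" "w \<in> lin_span K W S" "f n = c \<odot>\<^bsub>W\<^esub> s \<oplus>\<^bsub>W\<^esub> w"
      using lin_span_insertE[OF assms(3) S] insert.prems(3) n by blast
    have nV: "n \<in> carrier V" using n N by blast
    have c0: "c \<noteq> \<zero>\<^bsub>K\<^esub>"
    proof
      assume "c = \<zero>\<^bsub>K\<^esub>"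
      then have "f n = w" using cw S L by auto
      then show False using n cw nV by (auto simp: N'_def)
    qed
    have FV: "insert n F \<subseteq> carrier V" using F N n by (auto simp: N'_def)
    note LF = V.submoduleE[OF submodule_lin_span[OF assms(2) FV]]
    have "x \<in> lin_span K V (insert n F)" if x: "x \<in> N" for x
    proof -
      have xV: "x \<in> carrier V" using x N by blast
      obtain d w' where dw: "d \<in> carrier K" "w' \<in> lin_span K W S" "f x = d \<odot>\<^bsub>W\<^esub> s \<oplus>\<^bsub>W\<^esub> w'"
        using lin_span_insertE[OF assms(3) S] insert.prems(3) x by blast
      define e where "e = d \<otimes>\<^bsub>K\<^esub> inv\<^bsub>K\<^esub> c"
      have e: "e \<in> carrier K" "e \<otimes>\<^bsub>K\<^esub> c = d"
        using dw cw c0 by (auto simp: e_def K.m_assoc K.field_Units)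
      \<comment> \<open>the multiple of \<open>n\<close> is chosen so that \<open>s\<close> cancels in the image\<close>
      define y where "y = x \<oplus>\<^bsub>V\<^esub> \<ominus>\<^bsub>V\<^esub> (e \<odot>\<^bsub>V\<^esub> n)"
      have wW: "w \<in> carrier W" "w' \<in> carrier W" using cw dw L by auto
      have "f y = f x \<oplus>\<^bsub>W\<^esub> \<ominus>\<^bsub>W\<^esub> (e \<odot>\<^bsub>W\<^esub> f n)"
        using xV nV e assms by (simp add: y_def linear_map_add linear_map_smult linear_map_a_inv)
      also have "e \<odot>\<^bsub>W\<^esub> f n = d \<odot>\<^bsub>W\<^esub> s \<oplus>\<^bsub>W\<^esub> e \<odot>\<^bsub>W\<^esub> w"
        using cw(1) e S wW by (simp add: cw(3) W.smult_r_distr W.smult_assoc1[symmetric])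
      also have "f x \<oplus>\<^bsub>W\<^esub> \<ominus>\<^bsub>W\<^esub> \<dots> = (d \<odot>\<^bsub>W\<^esub> s \<oplus>\<^bsub>W\<^esub> \<ominus>\<^bsub>W\<^esub> (d \<odot>\<^bsub>W\<^esub> s)) \<oplus>\<^bsub>W\<^esub> (w' \<oplus>\<^bsub>W\<^esub> \<ominus>\<^bsub>W\<^esub> (e \<odot>\<^bsub>W\<^esub> w))"
        using dw(1) e S wW by (simp add: dw(3) W.minus_add W.add.m_ac del: W.r_neg)
      also have "\<dots> = w' \<oplus>\<^bsub>W\<^esub> \<ominus>\<^bsub>W\<^esub> (e \<odot>\<^bsub>W\<^esub> w)"
        using dw(1) e S wW by (simp add: W.r_neg)
      finally have "f y \<in> lin_span K W S" using L dw cw e by simp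
      moreover have "y \<in> N" using x n N e by (simp add: y_def)
      ultimately have "y \<in> N'" using N by (auto simp: N'_def)
      then have "y \<in> lin_span K V (insert n F)"
        using F(3) lin_span_mono[of F "insert n F"] by blast
      moreover have "e \<odot>\<^bsub>V\<^esub> n \<in> lin_span K V (insert n F)"
        by (intro LF(4) e(1) subsetD[OF lin_span_superset]) simp
      moreover have "x = y \<oplus>\<^bsub>V\<^esub> e \<odot>\<^bsub>V\<^esub> n"
        using xV nV e by (simp add: y_def V.a_assoc V.l_neg)
      ultimately show ?thesis using LF by simp
    qed
    then show ?thesis
      using F n by (intro exI[of _ "insert n F"]) (auto simp: N'_def)
  qed
qed

text \<open>A spanning set of least size is independent: in a nontrivial relation, an element with a nonzero
coefficient lies in the span of the others and could be dropped.\<close>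

lemma finite_basis_if_finitely_spanned:
  assumes "field K" "module K V" "finite S" "S \<subseteq> carrier V" "lin_span K V S = carrier V"
  shows "\<exists>B. finite B \<and> is_basis K V B"
proof -
  interpret K: field K by fact
  interpret V: module K V by fact
  let ?P = "\<lambda>T. finite T \<and> T \<subseteq> carrier V \<and> lin_span K V T = carrier V"
  obtain B where B: "?P B" and min: "\<And>T. ?P T \<Longrightarrow> card B \<le> card T"
    using arg_min_nat_lemma[of ?P S card] assms(3-5) by blast
  have "lin_indep K V B"
    unfolding lin_indep_def
  proof (intro allI impI ballI, elim conjE)
    fix F c x assume F: "finite F" "F \<subseteq> B" "c \<in> F \<rightarrow> carrier K" "x \<in> F"
      and sum: "(\<Oplus>\<^bsub>V\<^esub>x\<in>F. c x \<odot>\<^bsub>V\<^esub> x) = \<zero>\<^bsub>V\<^esub>"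
    show "c x = \<zero>\<^bsub>K\<^esub>"
    proof (rule ccontr)
      assume cx: "c x \<noteq> \<zero>\<^bsub>K\<^esub>"
      let ?L = "lin_span K V (B - {x})"
      have BV: "B - {x} \<subseteq> carrier V" using B by blast
      note L = V.submoduleE[OF submodule_lin_span[OF assms(2) BV]] lin_span_zero[OF assms(2) BV]
      have "(\<Oplus>\<^bsub>V\<^esub>y\<in>G. c y \<odot>\<^bsub>V\<^esub> y) \<in> ?L" if "finite G" "G \<subseteq> F - {x}" for G
        using that
      proof (induction G rule: finite_induct)
        case empty
        then show ?case using L by simp
      next
        case (insert y G)
        have yL: "y \<in> ?L" using insert F lin_span_superset[of "B - {x}" K V] by blast
        have "(\<Oplus>\<^bsub>V\<^esub>y\<in>insert y G. c y \<odot>\<^bsub>V\<^esub> y) = c y \<odot>\<^bsub>V\<^esub> y \<oplus>\<^bsub>V\<^esub> (\<Oplus>\<^bsub>V\<^esub>y\<in>G. c y \<odot>\<^bsub>V\<^esub> y)"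
          using insert F B by (intro V.finsum_insert) (auto intro!: V.smult_closed)
        moreover have "c y \<in> carrier K" using insert F by auto
        ultimately show ?case using insert yL L(4,5) by simp
      qed
      then have r: "(\<Oplus>\<^bsub>V\<^esub>y\<in>F - {x}. c y \<odot>\<^bsub>V\<^esub> y) \<in> ?L" (is "?r \<in> _") using F by simp
      have xV: "x \<in> carrier V" and cK: "c x \<in> carrier K" and rV: "?r \<in> carrier V"
        using F B r L by auto
      have "(\<Oplus>\<^bsub>V\<^esub>y\<in>insert x (F - {x}). c y \<odot>\<^bsub>V\<^esub> y) = c x \<odot>\<^bsub>V\<^esub> x \<oplus>\<^bsub>V\<^esub> ?r"
        using F B by (intro V.finsum_insert) (auto intro!: V.smult_closed)
      then have "c x \<odot>\<^bsub>V\<^esub> x \<oplus>\<^bsub>V\<^esub> ?r = \<zero>\<^bsub>V\<^esub>" using sum F by (simp add: insert_absorb)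
      then have "c x \<odot>\<^bsub>V\<^esub> x = \<ominus>\<^bsub>V\<^esub> ?r" using xV cK rV by (simp add: V.add.inv_equality V.minus_equality)
      then have "inv\<^bsub>K\<^esub> (c x) \<odot>\<^bsub>V\<^esub> (c x \<odot>\<^bsub>V\<^esub> x) \<in> ?L"
        using L r cK cx by (simp add: K.field_Units)
      also have "inv\<^bsub>K\<^esub> (c x) \<odot>\<^bsub>V\<^esub> (c x \<odot>\<^bsub>V\<^esub> x) = x"
        using cK cx xV by (simp add: V.smult_assoc1[symmetric] K.field_Units)
      finally have "x \<in> ?L" .
      then have "B \<subseteq> ?L" using lin_span_superset[of "B - {x}" K V] by blast
      then have "carrier V \<subseteq> ?L"
        using lin_span_least[OF submodule_lin_span[OF assms(2) BV]] B by blast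
      then have "?P (B - {x})" using B lin_span_subset_carrier[OF assms(2) BV] by blast
      then have "card B \<le> card (B - {x})" by (rule min)
      moreover have "card (B - {x}) < card B"
        using F B by (intro psubset_card_mono) auto
      ultimately show False by simp
    qed
  qed
  then show ?thesis using B by (auto simp: is_basis_def)
qed

lemma vdim_finite_iff: "vdim K V \<noteq> \<infinity> \<longleftrightarrow> (\<exists>B. finite B \<and> is_basis K V B)"
  by (simp add: vdim_def)

lemma vdim_finite_if_injective:
  assumes "field K" "module K V" "module K W" "linear_map K V W f"
    and "\<And>x. x \<in> carrier V \<Longrightarrow> f x = \<zero>\<^bsub>W\<^esub> \<Longrightarrow> x = \<zero>\<^bsub>V\<^esub>"
    and "finite S" "S \<subseteq> carrier W" "lin_span K W S = carrier W"
  shows "vdim K V \<noteq> \<infinity>"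
proof -
  have "f ` carrier V \<subseteq> lin_span K W S"
    using linear_map_closed[OF assms(4)] by (auto simp: assms(8))
  then obtain F where F: "finite F" "F \<subseteq> carrier V" "carrier V \<subseteq> lin_span K V F"
    using finitely_spanned_if_injective[OF assms(1-7) module.carrier_is_submodule[OF assms(2)]]
    by blast
  then have "lin_span K V F = carrier V" using lin_span_subset_carrier[OF assms(2)] by blast
  then have "\<exists>B. finite B \<and> is_basis K V B"
    by (rule finite_basis_if_finitely_spanned[OF assms(1,2) F(1,2)])
  then show ?thesis by (simp only: vdim_finite_iff)
qed

section \<open>Free and quotient modules\<close>

lemma free_module_simps:
  "carrier (free_module K X) = {f. (\<forall>x\<in>X. f x \<in> carrier K) \<and> (\<forall>x. x \<notin> X \<longrightarrow> f x = \<zero>\<^bsub>K\<^esub>) \<and>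
        finite {x. f x \<noteq> \<zero>\<^bsub>K\<^esub>}}"
  "zero (free_module K X) = (\<lambda>x. \<zero>\<^bsub>K\<^esub>)"
  "add (free_module K X) = (\<lambda>f g x. f x \<oplus>\<^bsub>K\<^esub> g x)"
  "smult (free_module K X) = (\<lambda>c f x. c \<otimes>\<^bsub>K\<^esub> f x)"
  by (simp_all add: free_module_def)

lemma module_free_module:
  assumes "field K" shows "module K (free_module K X)"
proof -
  interpret K: field K by fact
  let ?F = "free_module K X"
  have in_K: "f x \<in> carrier K" if "f \<in> carrier ?F" for f x
    using that by (cases "x \<in> X") (auto simp: free_module_simps)
  have fin: "finite {x. f x \<noteq> \<zero>\<^bsub>K\<^esub>}" if "f \<in> carrier ?F" for f
    using that by (auto simp: free_module_simps)
  have add_closed: "(\<lambda>x. f x \<oplus>\<^bsub>K\<^esub> g x) \<in> carrier ?F" if "f \<in> carrier ?F" "g \<in> carrier ?F" for f g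
  proof -
    have "{x. f x \<oplus>\<^bsub>K\<^esub> g x \<noteq> \<zero>\<^bsub>K\<^esub>} \<subseteq> {x. f x \<noteq> \<zero>\<^bsub>K\<^esub>} \<union> {x. g x \<noteq> \<zero>\<^bsub>K\<^esub>}" by auto
    then have "finite {x. f x \<oplus>\<^bsub>K\<^esub> g x \<noteq> \<zero>\<^bsub>K\<^esub>}"
      using fin that by (meson finite_UnI finite_subset)
    then show ?thesis using that by (auto simp: free_module_simps)
  qed
  have smult_closed: "(\<lambda>x. c \<otimes>\<^bsub>K\<^esub> f x) \<in> carrier ?F" if "c \<in> carrier K" "f \<in> carrier ?F" for c f
  proof -
    have "{x. c \<otimes>\<^bsub>K\<^esub> f x \<noteq> \<zero>\<^bsub>K\<^esub>} \<subseteq> {x. f x \<noteq> \<zero>\<^bsub>K\<^esub>}" using that by auto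
    then have "finite {x. c \<otimes>\<^bsub>K\<^esub> f x \<noteq> \<zero>\<^bsub>K\<^esub>}"
      using fin[OF that(2)] by (rule finite_subset)
    then show ?thesis using that by (auto simp: free_module_simps)
  qed
  show ?thesis
  proof (intro moduleI abelian_groupI)
    show "\<exists>g\<in>carrier ?F. g \<oplus>\<^bsub>?F\<^esub> f = \<zero>\<^bsub>?F\<^esub>" if f: "f \<in> carrier ?F" for f
    proof (intro bexI)
      show "(\<lambda>x. (\<ominus>\<^bsub>K\<^esub> \<one>\<^bsub>K\<^esub>) \<otimes>\<^bsub>K\<^esub> f x) \<in> carrier ?F" by (intro smult_closed f) simp
      show "(\<lambda>x. (\<ominus>\<^bsub>K\<^esub> \<one>\<^bsub>K\<^esub>) \<otimes>\<^bsub>K\<^esub> f x) \<oplus>\<^bsub>?F\<^esub> f = \<zero>\<^bsub>?F\<^esub>"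
        using in_K[OF f] by (simp add: free_module_simps(2-) K.l_minus K.l_neg)
    qed
  next
    show "cring K" by (rule K.is_cring)
  next
    show "\<zero>\<^bsub>?F\<^esub> \<in> carrier ?F" by (auto simp: free_module_simps)
  qed (use in_K add_closed smult_closed in \<open>auto simp: free_module_simps(2-) fun_eq_iff
      K.a_assoc K.a_comm K.a_lcomm K.l_distr K.r_distr K.m_assoc\<close>)
qed

lemma free_gen_closed:
  assumes "field K" "x \<in> X" shows "free_gen K x \<in> carrier (free_module K X)"
proof -
  interpret K: field K by fact
  have "finite {y. (if y = x then \<one>\<^bsub>K\<^esub> else \<zero>\<^bsub>K\<^esub>) \<noteq> \<zero>\<^bsub>K\<^esub>}"
    by (rule finite_subset[of _ "{x}"]) auto
  then show ?thesis using assms by (auto simp: free_module_simps free_gen_def)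
qed

text \<open>The linear extension of a map \<open>b\<close> on the generators.\<close>

definition free_lift :: "('k, 'r) ring_scheme \<Rightarrow> ('k, 'u, 'm) module_scheme
    \<Rightarrow> ('x \<Rightarrow> 'u) \<Rightarrow> ('x \<Rightarrow> 'k) \<Rightarrow> 'u"
  where "free_lift K U b f = (\<Oplus>\<^bsub>U\<^esub>x\<in>{x. f x \<noteq> \<zero>\<^bsub>K\<^esub>}. f x \<odot>\<^bsub>U\<^esub> b x)"

text \<open>Additivity needs the sums for \<open>f\<close>, \<open>g\<close> and \<open>f + g\<close> over one common index set, whereas each of the
three functions has its own support.\<close>

lemma free_lift_eq_sum:
  assumes "module K U" "b \<in> X \<rightarrow> carrier U" "f \<in> carrier (free_module K X)"
    and "finite Y" "Y \<subseteq> X" "{x. f x \<noteq> \<zero>\<^bsub>K\<^esub>} \<subseteq> Y"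
  shows "free_lift K U b f = (\<Oplus>\<^bsub>U\<^esub>x\<in>Y. f x \<odot>\<^bsub>U\<^esub> b x)"
proof -
  interpret U: module K U by fact
  have "f x \<odot>\<^bsub>U\<^esub> b x \<in> carrier U" if "x \<in> Y" for x
    using that assms by (intro U.smult_closed) (auto simp: free_module_simps)
  moreover have "f x \<odot>\<^bsub>U\<^esub> b x = \<zero>\<^bsub>U\<^esub>" if "x \<in> Y - {x. f x \<noteq> \<zero>\<^bsub>K\<^esub>}" for x
  proof -
    have "f x = \<zero>\<^bsub>K\<^esub>" "b x \<in> carrier U" using that assms by auto
    then show ?thesis by simp
  qed
  ultimately show ?thesis unfolding free_lift_def
    using assms(4,6) by (intro U.add.finprod_mono_neutral_cong_left) auto
qed

lemma linear_map_free_lift: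
  assumes "field K" "module K U" "b \<in> X \<rightarrow> carrier U"
  shows "linear_map K (free_module K X) U (free_lift K U b)"
proof -
  interpret K: field K by fact
  interpret U: module K U by fact
  let ?F = "free_module K X"
  interpret F: module K ?F by (rule module_free_module) fact
  let ?supp = "\<lambda>f. {x. f x \<noteq> \<zero>\<^bsub>K\<^esub>}"
  have supp: "finite (?supp f)" "?supp f \<subseteq> X" "f x \<in> carrier K"
    if "f \<in> carrier ?F" for f x
    using that by (cases "x \<in> X"; auto simp: free_module_simps)+
  have closed: "(\<lambda>x. f x \<odot>\<^bsub>U\<^esub> b x) \<in> Y \<rightarrow> carrier U" if "f \<in> carrier ?F" "Y \<subseteq> X" for f Y
    using that supp(3) assms(3) by (auto intro!: U.smult_closed)
  show ?thesis
  proof (intro linear_mapI)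
    fix f assume f: "f \<in> carrier ?F"
    show "free_lift K U b f \<in> carrier U"
      unfolding free_lift_def using closed[OF f] supp[OF f] by (intro U.finsum_closed) blast
  next
    fix f g assume fg: "f \<in> carrier ?F" "g \<in> carrier ?F"
    let ?Y = "?supp f \<union> ?supp g"
    have Y: "finite ?Y" "?Y \<subseteq> X" using supp fg by auto
    have fg': "f \<oplus>\<^bsub>?F\<^esub> g \<in> carrier ?F" using fg by simp
    have "?supp (f \<oplus>\<^bsub>?F\<^esub> g) \<subseteq> ?Y" by (auto simp: free_module_simps)
    then have "free_lift K U b (f \<oplus>\<^bsub>?F\<^esub> g) = (\<Oplus>\<^bsub>U\<^esub>x\<in>?Y. (f \<oplus>\<^bsub>?F\<^esub> g) x \<odot>\<^bsub>U\<^esub> b x)"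
      by (rule free_lift_eq_sum[OF assms(2,3) fg' Y])
    also have "\<dots> = (\<Oplus>\<^bsub>U\<^esub>x\<in>?Y. f x \<odot>\<^bsub>U\<^esub> b x \<oplus>\<^bsub>U\<^esub> g x \<odot>\<^bsub>U\<^esub> b x)"
    proof (intro U.finsum_cong' refl)
      show "(\<lambda>x. f x \<odot>\<^bsub>U\<^esub> b x \<oplus>\<^bsub>U\<^esub> g x \<odot>\<^bsub>U\<^esub> b x) \<in> ?Y \<rightarrow> carrier U"
        using closed[OF fg(1) Y(2)] closed[OF fg(2) Y(2)] by blast
      show "(f \<oplus>\<^bsub>?F\<^esub> g) x \<odot>\<^bsub>U\<^esub> b x = f x \<odot>\<^bsub>U\<^esub> b x \<oplus>\<^bsub>U\<^esub> g x \<odot>\<^bsub>U\<^esub> b x" if "x \<in> ?Y" for x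
      proof -
        have "b x \<in> carrier U" using that Y assms(3) by blast
        then show ?thesis
          using supp(3)[OF fg(1)] supp(3)[OF fg(2)] by (simp add: free_module_simps(3) U.smult_l_distr)
      qed
    qed
    also have "\<dots> = (\<Oplus>\<^bsub>U\<^esub>x\<in>?Y. f x \<odot>\<^bsub>U\<^esub> b x) \<oplus>\<^bsub>U\<^esub> (\<Oplus>\<^bsub>U\<^esub>x\<in>?Y. g x \<odot>\<^bsub>U\<^esub> b x)"
      by (intro U.finsum_addf closed fg Y)
    also have "(\<Oplus>\<^bsub>U\<^esub>x\<in>?Y. f x \<odot>\<^bsub>U\<^esub> b x) = free_lift K U b f"
      by (rule free_lift_eq_sum[OF assms(2,3) fg(1) Y, symmetric]) simp
    also have "(\<Oplus>\<^bsub>U\<^esub>x\<in>?Y. g x \<odot>\<^bsub>U\<^esub> b x) = free_lift K U b g"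
      by (rule free_lift_eq_sum[OF assms(2,3) fg(2) Y, symmetric]) simp
    finally show "free_lift K U b (f \<oplus>\<^bsub>?F\<^esub> g) = free_lift K U b f \<oplus>\<^bsub>U\<^esub> free_lift K U b g" .
  next
    fix c f assume c: "c \<in> carrier K" and f: "f \<in> carrier ?F"
    have cf: "c \<odot>\<^bsub>?F\<^esub> f \<in> carrier ?F" using c f by simp
    have "?supp (c \<odot>\<^bsub>?F\<^esub> f) \<subseteq> ?supp f" using c by (auto simp: free_module_simps)
    then have "free_lift K U b (c \<odot>\<^bsub>?F\<^esub> f) = (\<Oplus>\<^bsub>U\<^esub>x\<in>?supp f. (c \<odot>\<^bsub>?F\<^esub> f) x \<odot>\<^bsub>U\<^esub> b x)"
      by (rule free_lift_eq_sum[OF assms(2,3) cf supp(1,2)[OF f]])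
    also have "\<dots> = (\<Oplus>\<^bsub>U\<^esub>x\<in>?supp f. c \<odot>\<^bsub>U\<^esub> (f x \<odot>\<^bsub>U\<^esub> b x))"
    proof (intro U.finsum_cong' refl)
      show "(\<lambda>x. c \<odot>\<^bsub>U\<^esub> (f x \<odot>\<^bsub>U\<^esub> b x)) \<in> ?supp f \<rightarrow> carrier U"
        using closed[OF f supp(2)[OF f]] c by blast
      show "(c \<odot>\<^bsub>?F\<^esub> f) x \<odot>\<^bsub>U\<^esub> b x = c \<odot>\<^bsub>U\<^esub> (f x \<odot>\<^bsub>U\<^esub> b x)" if "x \<in> ?supp f" for x
      proof -
        have "b x \<in> carrier U" using that supp(2)[OF f] assms(3) by blast
        then show ?thesis
          using supp(3)[OF f] c by (simp add: free_module_simps(4) U.smult_assoc1)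
      qed
    qed
    also have "\<dots> = c \<odot>\<^bsub>U\<^esub> free_lift K U b f"
      unfolding free_lift_def
      by (intro U.finsum_smult_ldistr[symmetric] supp(1)[OF f] c closed[OF f supp(2)[OF f]])
    finally show "free_lift K U b (c \<odot>\<^bsub>?F\<^esub> f) = c \<odot>\<^bsub>U\<^esub> free_lift K U b f" .
  qed
qed

lemma free_lift_gen:
  assumes "field K" "module K U" "b \<in> X \<rightarrow> carrier U" "x \<in> X"
  shows "free_lift K U b (free_gen K x) = b x"
proof -
  interpret K: field K by fact
  interpret U: module K U by fact
  have "{y. free_gen K x y \<noteq> \<zero>\<^bsub>K\<^esub>} = {x}" by (auto simp: free_gen_def)
  moreover have "b x \<in> carrier U" using assms(3,4) by blast
  ultimately show ?thesis by (simp add: free_lift_def free_gen_def)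
qed

text \<open>The generators span. Induction on the support, splitting off one coordinate \<open>y\<close> at a time.\<close>

lemma free_module_subset_submodule:
  assumes "field K" "submodule N K (free_module K X)" "\<And>x. x \<in> X \<Longrightarrow> free_gen K x \<in> N"
  shows "carrier (free_module K X) \<subseteq> N"
proof
  fix f assume f: "f \<in> carrier (free_module K X)"
  interpret K: field K by fact
  let ?F = "free_module K X"
  interpret F: module K ?F by (rule module_free_module) fact
  note N = F.submoduleE[OF assms(2)]
  have zN: "\<zero>\<^bsub>?F\<^esub> \<in> N"
    using subgroup.one_closed[OF submodule.axioms(1)[OF assms(2)]] by simp
  have "f \<in> N" if "finite Y" "f \<in> carrier ?F" "{x. f x \<noteq> \<zero>\<^bsub>K\<^esub>} \<subseteq> Y" for Y f
    using that
  proof (induction Y arbitrary: f rule: finite_induct)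
    case empty
    then have "f = \<zero>\<^bsub>?F\<^esub>" by (auto simp: free_module_simps)
    then show ?case using zN by simp
  next
    case (insert y Y)
    show ?case
    proof (cases "y \<in> X")
      case False
      then have "f y = \<zero>\<^bsub>K\<^esub>" using insert.prems by (auto simp: free_module_simps)
      then show ?thesis using insert by blast
    next
      case True
      have fK: "f x \<in> carrier K" for x
        using insert.prems(1) by (cases "x \<in> X") (auto simp: free_module_simps)
      define g where "g = f(y := \<zero>\<^bsub>K\<^esub>)"
      have "finite {x. g x \<noteq> \<zero>\<^bsub>K\<^esub>}"
        using insert.hyps(1) by (rule finite_subset[rotated]) (use insert.prems(2) in \<open>auto simp: g_def\<close>)
      then have "g \<in> carrier ?F"
        using insert.prems(1) by (auto simp: free_module_simps g_def)
      moreover have "{x. g x \<noteq> \<zero>\<^bsub>K\<^esub>} \<subseteq> Y" using insert.prems(2) by (auto simp: g_def)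
      ultimately have "g \<in> N" by (rule insert.IH)
      moreover have "f = f y \<odot>\<^bsub>?F\<^esub> free_gen K y \<oplus>\<^bsub>?F\<^esub> g"
        using fK by (auto simp: free_module_simps(3,4) g_def free_gen_def)
      ultimately show ?thesis using N(4)[OF fK assms(3)[OF True]] N(5) by metis
    qed
  qed
  moreover have "finite {x. f x \<noteq> \<zero>\<^bsub>K\<^esub>}" using f by (auto simp: free_module_simps)
  ultimately show "f \<in> N" using f by blast
qed

lemma quotient_module_simps:
  "carrier (quotient_module M N) = a_rcosets\<^bsub>M\<^esub> N"
  "zero (quotient_module M N) = N"
  "add (quotient_module M N) = set_add M"
  "smult (quotient_module M N) = (\<lambda>c X. \<Union>x\<in>X. N +>\<^bsub>M\<^esub> (c \<odot>\<^bsub>M\<^esub> x))"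
  by (simp_all add: quotient_module_def ring.defs module.defs FactRing_def)

text \<open>The quotient \<open>M / N\<close> and its universal property, through cosets \<open>N +> x\<close>.\<close>

locale submodule_of_module = module K M for K and M (structure) + fixes N
  assumes submodule: "submodule N K M"
begin

lemma abelian_subgroup: "abelian_subgroup N M"
  using submodule.axioms(1)[OF submodule]
  by (intro abelian_subgroupI3 additive_subgroupI M.abelian_group_axioms)

sublocale N: abelian_subgroup N M
  by (rule abelian_subgroup)

abbreviation "Q \<equiv> quotient_module M N"

lemma coset_closed: "x \<in> carrier M \<Longrightarrow> N +> x \<in> carrier Q"
  by (simp add: quotient_module_simps a_rcosetsI N.a_subset)

lemma cosetE:
  assumes "X \<in> carrier Q"
  obtains x where "x \<in> carrier M" "X = N +> x"
  using assms by (auto simp: quotient_module_simps A_RCOSETS_def' a_r_coset_def')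

lemma coset_eq_iff:
  assumes "x \<in> carrier M" "y \<in> carrier M"
  shows "N +> x = N +> y \<longleftrightarrow> x \<ominus> y \<in> N"
  using assms N.a_rcos_module[OF assms(2,1)] N.a_rcos_self[OF assms(1)]
    N.a_repr_independence'[OF _ assms(2), of x] by (auto simp: a_minus_def)

lemma coset_add:
  assumes "x \<in> carrier M" "y \<in> carrier M"
  shows "(N +> x) \<oplus>\<^bsub>Q\<^esub> (N +> y) = N +> (x \<oplus> y)"
  using assms by (simp add: quotient_module_simps N.a_rcos_sum)

lemma coset_smult:
  assumes "c \<in> carrier K" "x \<in> carrier M"
  shows "c \<odot>\<^bsub>Q\<^esub> (N +> x) = N +> (c \<odot> x)"
proof -
  \<comment> \<open>the union in \<open>quotient_module_def\<close> is over equal cosets, so any representative may be used\<close>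
  have "N +> (c \<odot> y) = N +> (c \<odot> x)" if y: "y \<in> N +> x" for y
  proof -
    have yM: "y \<in> carrier M" using y N.a_subset assms(2) M.a_r_coset_subset_G by blast
    have "y \<ominus> x \<in> N"
      using N.a_rcos_module_imp[OF assms(2) y] by (simp add: a_minus_def)
    then have "c \<odot> (y \<ominus> x) \<in> N" by (rule submoduleE(4)[OF submodule assms(1)])
    also have "c \<odot> (y \<ominus> x) = c \<odot> y \<ominus> c \<odot> x"
      using assms yM by (simp add: a_minus_def smult_r_distr smult_r_minus)
    finally show ?thesis using assms yM by (simp add: coset_eq_iff)
  qed
  moreover have "N +> x \<noteq> {}" using N.a_rcos_self[OF assms(2)] by blast
  ultimately show ?thesis unfolding quotient_module_simps by (intro SUP_eq_const)
qed

lemma coset_zero: "N +> \<zero> = \<zero>\<^bsub>Q\<^esub>"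
  by (simp add: quotient_module_simps N.a_subset)

lemma module_quotient: "module K Q"
proof (intro moduleI abelian_groupI)
  show "cring K" by (rule R.is_cring)
  show "\<zero>\<^bsub>Q\<^esub> \<in> carrier Q" using coset_closed[OF M.zero_closed] by (simp add: coset_zero)
  show "\<exists>Y\<in>carrier Q. Y \<oplus>\<^bsub>Q\<^esub> X = \<zero>\<^bsub>Q\<^esub>" if X: "X \<in> carrier Q" for X
  proof -
    obtain x where x: "x \<in> carrier M" "X = N +> x" using cosetE[OF X] by blast
    then have "(N +> (\<ominus> x)) \<oplus>\<^bsub>Q\<^esub> X = \<zero>\<^bsub>Q\<^esub>" by (simp add: coset_add M.l_neg coset_zero)
    then show ?thesis using x coset_closed by blast
  qed
qed (elim cosetE; simp add: coset_closed coset_add coset_smult coset_zero[symmetric] M.a_ac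
      smult_l_distr smult_r_distr smult_assoc1)+

lemma linear_map_coset: "linear_map K M Q (\<lambda>x. N +> x)"
  by (intro linear_mapI) (simp_all add: coset_closed coset_add coset_smult)

lemma quotient_lift:
  assumes "module K U" "linear_map K M U f" "\<And>x. x \<in> N \<Longrightarrow> f x = \<zero>\<^bsub>U\<^esub>"
  obtains h where "h \<in> lin_hom K Q U" "\<And>x. x \<in> carrier M \<Longrightarrow> h (N +> x) = f x"
proof -
  interpret U: module K U by fact
  define h where "h = (\<lambda>X\<in>carrier Q. f (SOME x. x \<in> carrier M \<and> X = N +> x))"
  have h: "h (N +> x) = f x" if x: "x \<in> carrier M" for x
  proof -
    define y where "y = (SOME y. y \<in> carrier M \<and> N +> x = N +> y)"
    have "y \<in> carrier M \<and> N +> x = N +> y"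
      unfolding y_def by (rule someI[of _ x]) (simp add: x)
    then have y: "y \<in> carrier M" "y \<ominus> x \<in> N" using coset_eq_iff x by metis+
    then have "f y \<ominus>\<^bsub>U\<^esub> f x = \<zero>\<^bsub>U\<^esub>"
      using assms(3)[OF y(2)] linear_map_minus[OF module_axioms assms(1,2) y(1) x] by simp
    moreover have "f x \<in> carrier U" "f y \<in> carrier U"
      using linear_map_closed[OF assms(2)] x y by auto
    ultimately have "f y = f x"
      using U.minus_equality[of "f y" "\<ominus>\<^bsub>U\<^esub> f x"] by (simp add: a_minus_def)
    then show ?thesis using coset_closed[OF x] by (simp add: h_def y_def)
  qed
  have "h \<in> lin_hom K Q U"
    unfolding lin_hom_def
  proof (intro CollectI conjI ballI PiE_I)
    show "h X \<in> carrier U" if "X \<in> carrier Q" for X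
      using that h linear_map_closed[OF assms(2)] by (metis cosetE)
    show "h X = undefined" if "X \<notin> carrier Q" for X
      using that by (simp add: h_def)
    show "h (X \<oplus>\<^bsub>Q\<^esub> Y) = h X \<oplus>\<^bsub>U\<^esub> h Y" if "X \<in> carrier Q" "Y \<in> carrier Q" for X Y
      using that by (elim cosetE) (simp add: coset_add h linear_map_add[OF assms(2)])
    show "h (c \<odot>\<^bsub>Q\<^esub> X) = c \<odot>\<^bsub>U\<^esub> h X" if "c \<in> carrier K" "X \<in> carrier Q" for c X
      using that by (elim cosetE) (simp add: coset_smult h linear_map_smult[OF assms(2)])
  qed
  then show thesis using h that by blast
qed

end

section \<open>Tensor products\<close>

definition bilinear_map :: "('k, 'r) ring_scheme \<Rightarrow> ('k, 'v, 'm) module_scheme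
    \<Rightarrow> ('k, 'w, 'n) module_scheme \<Rightarrow> ('k, 'u, 'l) module_scheme \<Rightarrow> ('v \<Rightarrow> 'w \<Rightarrow> 'u) \<Rightarrow> bool"
  where "bilinear_map K V W U b \<longleftrightarrow>
    (\<forall>w\<in>carrier W. linear_map K V U (\<lambda>v. b v w)) \<and> (\<forall>v\<in>carrier V. linear_map K W U (b v))"

lemma bilinear_mapI:
  assumes "\<And>w. w \<in> carrier W \<Longrightarrow> linear_map K V U (\<lambda>v. b v w)"
    and "\<And>v. v \<in> carrier V \<Longrightarrow> linear_map K W U (b v)"
  shows "bilinear_map K V W U b"
  using assms by (simp add: bilinear_map_def)

lemma bilinear_map_left: "bilinear_map K V W U b \<Longrightarrow> w \<in> carrier W \<Longrightarrow> linear_map K V U (\<lambda>v. b v w)"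
  by (simp add: bilinear_map_def)

lemma bilinear_map_right: "bilinear_map K V W U b \<Longrightarrow> v \<in> carrier V \<Longrightarrow> linear_map K W U (b v)"
  by (simp add: bilinear_map_def)

lemma bilinear_map_closed:
  "bilinear_map K V W U b \<Longrightarrow> v \<in> carrier V \<Longrightarrow> w \<in> carrier W \<Longrightarrow> b v w \<in> carrier U"
  by (auto simp: bilinear_map_def linear_map_def)

lemma tensor_kernel_submodule:
  assumes "field K" "module K V" "module K W"
  shows "tensor_relators K V W \<subseteq> carrier (free_module K (carrier V \<times> carrier W))"
    and "submodule_of_module K (free_module K (carrier V \<times> carrier W)) (tensor_kernel K V W)"
proof -
  let ?F = "free_module K (carrier V \<times> carrier W)"
  interpret V: module K V by fact
  interpret W: module K W by fact
  interpret F: module K ?F by (rule module_free_module) fact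
  have g: "free_gen K (v, w) \<in> carrier ?F" if "v \<in> carrier V" "w \<in> carrier W" for v w
    using that by (intro free_gen_closed assms(1)) simp
  show sub: "tensor_relators K V W \<subseteq> carrier ?F"
    unfolding tensor_relators_def Let_def by (auto simp: g)
  show "submodule_of_module K ?F (tensor_kernel K V W)"
    unfolding tensor_kernel_def
    by (intro submodule_of_module.intro submodule_of_module_axioms.intro submodule_lin_span
        F.module_axioms sub)
qed

lemma module_tensor_product:
  assumes "field K" "module K V" "module K W"
  shows "module K (tensor_product K V W)"
  unfolding tensor_product_def
  by (rule submodule_of_module.module_quotient[OF tensor_kernel_submodule(2)[OF assms]])

text \<open>The four kinds of relators are exactly the four identities of bilinearity.\<close>

lemma bilinear_map_pure_tensor:
  assumes "field K" "module K V" "module K W"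
  shows "bilinear_map K V W (tensor_product K V W) (pure_tensor K V W)"
proof -
  let ?F = "free_module K (carrier V \<times> carrier W)"
  let ?g = "\<lambda>v w. free_gen K (v, w)"
  interpret V: module K V by fact
  interpret W: module K W by fact
  interpret T: submodule_of_module K ?F "tensor_kernel K V W"
    using assms by (rule tensor_kernel_submodule(2))
  have g: "?g v w \<in> carrier ?F" if "v \<in> carrier V" "w \<in> carrier W" for v w
    using that by (intro free_gen_closed assms(1)) simp
  have rel: "x \<in> tensor_kernel K V W" if "x \<in> tensor_relators K V W" for x
    unfolding tensor_kernel_def by (rule subsetD[OF lin_span_superset that])
  show ?thesis
  proof (intro bilinear_mapI linear_mapI; unfold pure_tensor_def tensor_product_def)
    fix v v' w assume *: "v \<in> carrier V" "v' \<in> carrier V" "w \<in> carrier W"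
    have "?g (v \<oplus>\<^bsub>V\<^esub> v') w \<ominus>\<^bsub>?F\<^esub> (?g v w \<oplus>\<^bsub>?F\<^esub> ?g v' w) \<in> tensor_kernel K V W"
      by (rule rel, unfold tensor_relators_def Let_def, rule UnI1, rule UnI1, rule UnI1)
        (rule CollectI, rule exI[of _ v], rule exI[of _ "v'"], rule exI[of _ "w"], simp add: *)
    then show "tensor_kernel K V W +>\<^bsub>?F\<^esub> ?g (v \<oplus>\<^bsub>V\<^esub> v') w =
        (tensor_kernel K V W +>\<^bsub>?F\<^esub> ?g v w) \<oplus>\<^bsub>T.Q\<^esub> (tensor_kernel K V W +>\<^bsub>?F\<^esub> ?g v' w)"
      using * by (simp add: T.coset_add T.coset_eq_iff g)
  next
    fix v w w' assume *: "v \<in> carrier V" "w \<in> carrier W" "w' \<in> carrier W"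
    have "?g v (w \<oplus>\<^bsub>W\<^esub> w') \<ominus>\<^bsub>?F\<^esub> (?g v w \<oplus>\<^bsub>?F\<^esub> ?g v w') \<in> tensor_kernel K V W"
      by (rule rel, unfold tensor_relators_def Let_def, rule UnI1, rule UnI1, rule UnI2)
        (rule CollectI, rule exI[of _ v], rule exI[of _ "w"], rule exI[of _ "w'"], simp add: *)
    then show "tensor_kernel K V W +>\<^bsub>?F\<^esub> ?g v (w \<oplus>\<^bsub>W\<^esub> w') =
        (tensor_kernel K V W +>\<^bsub>?F\<^esub> ?g v w) \<oplus>\<^bsub>T.Q\<^esub> (tensor_kernel K V W +>\<^bsub>?F\<^esub> ?g v w')"
      using * by (simp add: T.coset_add T.coset_eq_iff g)
  next
    fix c v w assume *: "c \<in> carrier K" "v \<in> carrier V" "w \<in> carrier W"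
    have "?g (c \<odot>\<^bsub>V\<^esub> v) w \<ominus>\<^bsub>?F\<^esub> (c \<odot>\<^bsub>?F\<^esub> ?g v w) \<in> tensor_kernel K V W"
      by (rule rel, unfold tensor_relators_def Let_def, rule UnI1, rule UnI2)
        (rule CollectI, rule exI[of _ c], rule exI[of _ "v"], rule exI[of _ "w"], simp add: *)
    then show "tensor_kernel K V W +>\<^bsub>?F\<^esub> ?g (c \<odot>\<^bsub>V\<^esub> v) w =
        c \<odot>\<^bsub>T.Q\<^esub> (tensor_kernel K V W +>\<^bsub>?F\<^esub> ?g v w)"
      using * by (simp add: T.coset_smult T.coset_eq_iff g)
    have "?g v (c \<odot>\<^bsub>W\<^esub> w) \<ominus>\<^bsub>?F\<^esub> (c \<odot>\<^bsub>?F\<^esub> ?g v w) \<in> tensor_kernel K V W"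
      by (rule rel, unfold tensor_relators_def Let_def, rule UnI2)
        (rule CollectI, rule exI[of _ c], rule exI[of _ "v"], rule exI[of _ "w"], simp add: *)
    then show "tensor_kernel K V W +>\<^bsub>?F\<^esub> ?g v (c \<odot>\<^bsub>W\<^esub> w) =
        c \<odot>\<^bsub>T.Q\<^esub> (tensor_kernel K V W +>\<^bsub>?F\<^esub> ?g v w)"
      using * by (simp add: T.coset_smult T.coset_eq_iff g)
  qed (simp_all add: T.coset_closed g)
qed

text \<open>Pure tensors span. Stated with an arbitrary submodule, this serves as an induction rule for
elements of the tensor product.\<close>

lemma tensor_subset_submodule:
  assumes "field K" "module K V" "module K W" "submodule N K (tensor_product K V W)"
    and pure: "\<And>v w. v \<in> carrier V \<Longrightarrow> w \<in> carrier W \<Longrightarrow> pure_tensor K V W v w \<in> N"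
  shows "carrier (tensor_product K V W) \<subseteq> N"
proof
  let ?F = "free_module K (carrier V \<times> carrier W)"
  interpret T: submodule_of_module K ?F "tensor_kernel K V W"
    using assms(1-3) by (rule tensor_kernel_submodule(2))
  let ?\<pi> = "\<lambda>f. tensor_kernel K V W +>\<^bsub>?F\<^esub> f"
  have "submodule {f \<in> carrier ?F. ?\<pi> f \<in> N} K ?F"
    using assms(4) unfolding tensor_product_def
    by (intro submodule_vimage[OF T.module_axioms T.module_quotient T.linear_map_coset])
  then have "carrier ?F \<subseteq> {f \<in> carrier ?F. ?\<pi> f \<in> N}"
    by (rule free_module_subset_submodule[OF assms(1)])
      (use pure in \<open>auto simp: pure_tensor_def free_gen_closed[OF assms(1)]\<close>)
  then show "t \<in> N" if "t \<in> carrier (tensor_product K V W)" for t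
    using that unfolding tensor_product_def by (auto elim!: T.cosetE)
qed

text \<open>The reason for every identity of maps on tensor products below: the elements on which two linear
maps agree form a submodule.\<close>

lemma tensor_ext:
  assumes "field K" "module K V" "module K W" "module K U"
    and "linear_map K (tensor_product K V W) U f" "linear_map K (tensor_product K V W) U g"
    and "\<And>v w. v \<in> carrier V \<Longrightarrow> w \<in> carrier W \<Longrightarrow>
      f (pure_tensor K V W v w) = g (pure_tensor K V W v w)"
    and "t \<in> carrier (tensor_product K V W)"
  shows "f t = g t"
proof -
  have "carrier (tensor_product K V W) \<subseteq> {t \<in> carrier (tensor_product K V W). f t = g t}"
    using assms(7) bilinear_map_closed[OF bilinear_map_pure_tensor[OF assms(1-3)]]
    by (intro tensor_subset_submodule[OF assms(1-3)] submodule_equalizer[OF _ assms(4-6)]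
        module_tensor_product[OF assms(1-3)]) auto
  then show ?thesis using assms(8) by blast
qed

text \<open>Extend \<open>b\<close> linearly to the free module. Bilinearity says that this extension kills the relators,
hence their span, so that it factors through the quotient.\<close>

lemma tensor_lift_exists:
  assumes "field K" "module K V" "module K W" "module K U" and b: "bilinear_map K V W U b"
  obtains h where "h \<in> lin_hom K (tensor_product K V W) U"
    and "\<And>v w. v \<in> carrier V \<Longrightarrow> w \<in> carrier W \<Longrightarrow> h (pure_tensor K V W v w) = b v w"
proof -
  let ?F = "free_module K (carrier V \<times> carrier W)"
  let ?g = "\<lambda>v w. free_gen K (v, w)"
  interpret V: module K V by fact
  interpret W: module K W by fact
  interpret U: module K U by fact
  interpret T: submodule_of_module K ?F "tensor_kernel K V W"
    using assms(1-3) by (rule tensor_kernel_submodule(2))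
  have g: "?g v w \<in> carrier ?F" if "v \<in> carrier V" "w \<in> carrier W" for v w
    using that by (intro free_gen_closed assms(1)) simp
  define \<phi> where "\<phi> = free_lift K U (\<lambda>(v, w). b v w)"
  have bc: "(\<lambda>(v, w). b v w) \<in> carrier V \<times> carrier W \<rightarrow> carrier U"
    using bilinear_map_closed[OF b] by auto
  have lin: "linear_map K ?F U \<phi>"
    unfolding \<phi>_def by (rule linear_map_free_lift[OF assms(1,4) bc])
  have \<phi>g: "\<phi> (?g v w) = b v w" if "v \<in> carrier V" "w \<in> carrier W" for v w
    using free_lift_gen[OF assms(1,4) bc, of "(v, w)"] that by (simp add: \<phi>_def)
  note \<phi>_simps = linear_map_minus[OF T.module_axioms assms(4) lin] linear_map_add[OF lin]
    linear_map_smult[OF lin] \<phi>g g bilinear_map_closed[OF b]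
    linear_map_add[OF bilinear_map_left[OF b]] linear_map_add[OF bilinear_map_right[OF b]]
    linear_map_smult[OF bilinear_map_left[OF b]] linear_map_smult[OF bilinear_map_right[OF b]]
  have "tensor_relators K V W \<subseteq> {f \<in> carrier ?F. \<phi> f \<in> {\<zero>\<^bsub>U\<^esub>}}"
    unfolding tensor_relators_def Let_def
    by (auto simp: \<phi>_simps a_minus_def[of U] U.r_neg)
  then have "tensor_kernel K V W \<subseteq> {f \<in> carrier ?F. \<phi> f \<in> {\<zero>\<^bsub>U\<^esub>}}"
    unfolding tensor_kernel_def
    by (intro lin_span_least submodule_vimage[OF T.module_axioms assms(4) lin]
        submodule_zero_singleton assms)
  then have "\<And>x. x \<in> tensor_kernel K V W \<Longrightarrow> \<phi> x = \<zero>\<^bsub>U\<^esub>" by blast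
  then obtain h where h: "h \<in> lin_hom K T.Q U"
    "\<And>x. x \<in> carrier ?F \<Longrightarrow> h (tensor_kernel K V W +>\<^bsub>?F\<^esub> x) = \<phi> x"
    using T.quotient_lift[OF assms(4) lin] by blast
  show thesis
  proof (rule that)
    show "h \<in> lin_hom K (tensor_product K V W) U" using h(1) by (simp add: tensor_product_def)
    show "h (pure_tensor K V W v w) = b v w" if "v \<in> carrier V" "w \<in> carrier W" for v w
      using that by (simp add: pure_tensor_def h(2) g \<phi>g)
  qed
qed

lemma lin_hom_eqI:
  assumes "f \<in> lin_hom K V W" "g \<in> lin_hom K V W" "\<And>x. x \<in> carrier V \<Longrightarrow> f x = g x"
  shows "f = g"
  using assms by (intro PiE_ext[of f "carrier V" "\<lambda>_. carrier W" g]) (auto simp: lin_hom_def)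

text \<open>Uniqueness follows from \<open>tensor_ext\<close>, as members of \<^const>\<open>lin_hom\<close> are extensional; the
definite description in \<^const>\<open>tensor_lift\<close> is therefore meaningful.\<close>

lemma tensor_lift_universal:
  assumes "field K" "module K V" "module K W" "module K U" "bilinear_map K V W U b"
  shows "tensor_lift K V W U b \<in> lin_hom K (tensor_product K V W) U \<and>
    (\<forall>v\<in>carrier V. \<forall>w\<in>carrier W. tensor_lift K V W U b (pure_tensor K V W v w) = b v w)"
proof -
  let ?P = "\<lambda>h. h \<in> lin_hom K (tensor_product K V W) U \<and>
    (\<forall>v\<in>carrier V. \<forall>w\<in>carrier W. h (pure_tensor K V W v w) = b v w)"
  have "\<exists>!h. ?P h"
  proof (rule ex_ex1I)
    show "\<exists>h. ?P h" using tensor_lift_exists[OF assms] by metis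
  next
    fix h h' assume hh: "?P h" "?P h'"
    show "h = h'"
    proof (rule lin_hom_eqI[where V = "tensor_product K V W" and W = U and K = K])
      show "h \<in> lin_hom K (tensor_product K V W) U" "h' \<in> lin_hom K (tensor_product K V W) U"
        using hh by auto
      then show "h t = h' t" if "t \<in> carrier (tensor_product K V W)" for t
        by (rule tensor_ext[OF assms(1-4) linear_map_if_lin_hom linear_map_if_lin_hom _ that])
          (simp add: hh)
    qed
  qed
  then show ?thesis unfolding tensor_lift_def by (rule theI')
qed

lemma linear_map_tensor_lift:
  assumes "field K" "module K V" "module K W" "module K U" "bilinear_map K V W U b"
  shows "linear_map K (tensor_product K V W) U (tensor_lift K V W U b)"
  by (rule linear_map_if_lin_hom[OF conjunct1[OF tensor_lift_universal[OF assms]]])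

lemma tensor_lift_pure:
  assumes "field K" "module K V" "module K W" "module K U" "bilinear_map K V W U b"
    and "v \<in> carrier V" "w \<in> carrier W"
  shows "tensor_lift K V W U b (pure_tensor K V W v w) = b v w"
  by (rule conjunct2[OF tensor_lift_universal[OF assms(1-5)], rule_format, OF assms(6,7)])

lemma linear_map_sum:
  assumes "module K V" "module K W" "linear_map K V W f" "linear_map K V W g"
  shows "linear_map K V W (\<lambda>x. f x \<oplus>\<^bsub>W\<^esub> g x)"
proof -
  interpret V: module K V by fact
  interpret W: module K W by fact
  note c = linear_map_closed[OF assms(3)] linear_map_closed[OF assms(4)]
  show ?thesis
    by (intro linear_mapI)
      (simp_all add: c linear_map_add[OF assms(3)] linear_map_add[OF assms(4)]
        linear_map_smult[OF assms(3)] linear_map_smult[OF assms(4)] W.smult_r_distr W.add.m_ac)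
qed

lemma linear_map_scale:
  assumes "module K V" "module K W" "linear_map K V W f" "c \<in> carrier K"
  shows "linear_map K V W (\<lambda>x. c \<odot>\<^bsub>W\<^esub> f x)"
proof -
  interpret V: module K V by fact
  interpret W: module K W by fact
  note * = linear_map_closed[OF assms(3)] assms(4)
  show ?thesis
    by (intro linear_mapI)
      (simp_all add: * linear_map_add[OF assms(3)] linear_map_smult[OF assms(3)]
        W.smult_r_distr W.smult_assoc1[symmetric] V.R.m_comm)
qed

text \<open>A family of bilinear maps that depends linearly on a parameter \<open>w\<close> induces maps on \<open>U \<otimes> V\<close> that
depend linearly on \<open>w\<close>. This is what makes the nested lifts in \<^const>\<open>tensor_assoc\<close> and
\<^const>\<open>tensor_assoc_inv\<close> bilinear.\<close>

lemma linear_map_tensor_lift_parameter: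
  assumes "field K" "module K U" "module K V" "module K T"
    and bil: "\<And>w. w \<in> carrier W \<Longrightarrow> bilinear_map K U V T (b w)"
    and lin: "\<And>u v. u \<in> carrier U \<Longrightarrow> v \<in> carrier V \<Longrightarrow> linear_map K W T (\<lambda>w. b w u v)"
    and "module K W" "t \<in> carrier (tensor_product K U V)"
  shows "linear_map K W T (\<lambda>w. tensor_lift K U V T (b w) t)"
proof (rule linear_mapI)
  interpret W: module K W by fact
  note ext = tensor_ext[OF assms(1-4) _ _ _ assms(8)]
  note lift = linear_map_tensor_lift[OF assms(1-4) bil]
  note pure = tensor_lift_pure[OF assms(1-4) bil]
  note mod = module_tensor_product[OF assms(1-3)]
  fix w assume w: "w \<in> carrier W"
  show "tensor_lift K U V T (b w) t \<in> carrier T"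
    using lift[OF w] assms(8) by (rule linear_map_closed)
  show "tensor_lift K U V T (b (w \<oplus>\<^bsub>W\<^esub> w')) t =
      tensor_lift K U V T (b w) t \<oplus>\<^bsub>T\<^esub> tensor_lift K U V T (b w') t" if w': "w' \<in> carrier W" for w'
    by (rule ext[OF lift linear_map_sum[OF mod assms(4) lift lift]])
      (use w w' in \<open>simp_all add: pure linear_map_add[OF lin]\<close>)
  show "tensor_lift K U V T (b (c \<odot>\<^bsub>W\<^esub> w)) t = c \<odot>\<^bsub>T\<^esub> tensor_lift K U V T (b w) t"
    if c: "c \<in> carrier K" for c
    by (rule ext[OF lift linear_map_scale[OF mod assms(4) lift]])
      (use w c in \<open>simp_all add: pure linear_map_smult[OF lin]\<close>)
qed

lemma bilinear_map_compose:
  assumes "bilinear_map K V' W' U b" "linear_map K V V' f" "linear_map K W W' g"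
  shows "bilinear_map K V W U (\<lambda>v w. b (f v) (g w))"
proof (rule bilinear_mapI)
  show "linear_map K V U (\<lambda>v. b (f v) (g w))" if "w \<in> carrier W" for w
    using bilinear_map_left[OF assms(1) linear_map_closed[OF assms(3) that]] assms(2)
    by (rule linear_map_compose)
  show "linear_map K W U (\<lambda>w. b (f v) (g w))" if "v \<in> carrier V" for v
    using bilinear_map_right[OF assms(1) linear_map_closed[OF assms(2) that]] assms(3)
    by (rule linear_map_compose)
qed

lemma tensor_map_properties:
  assumes "field K" "module K V" "module K W" "module K V'" "module K W'"
    and "linear_map K V V' f" "linear_map K W W' g"
  shows linear_map_tensor_map:
      "linear_map K (tensor_product K V W) (tensor_product K V' W') (tensor_map K V W V' W' f g)"
    and tensor_map_pure: "v \<in> carrier V \<Longrightarrow> w \<in> carrier W \<Longrightarrow>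
      tensor_map K V W V' W' f g (pure_tensor K V W v w) = pure_tensor K V' W' (f v) (g w)"
proof -
  note b = bilinear_map_compose[OF bilinear_map_pure_tensor[OF assms(1,4,5)] assms(6,7)]
  note m = module_tensor_product[OF assms(1,4,5)]
  show "linear_map K (tensor_product K V W) (tensor_product K V' W') (tensor_map K V W V' W' f g)"
    unfolding tensor_map_def by (rule linear_map_tensor_lift[OF assms(1-3) m b])
  show "tensor_map K V W V' W' f g (pure_tensor K V W v w) = pure_tensor K V' W' (f v) (g w)"
    if "v \<in> carrier V" "w \<in> carrier W"
    unfolding tensor_map_def by (rule tensor_lift_pure[OF assms(1-3) m b that])
qed

lemma tensor_assoc_properties:
  assumes "field K" "module K U" "module K V" "module K W"
  shows linear_map_tensor_assoc:
      "linear_map K (tensor_product K (tensor_product K U V) W)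
        (tensor_product K U (tensor_product K V W)) (tensor_assoc K U V W)"
    and tensor_assoc_pure: "\<And>u v w. u \<in> carrier U \<Longrightarrow> v \<in> carrier V \<Longrightarrow> w \<in> carrier W \<Longrightarrow>
      tensor_assoc K U V W (pure_tensor K (tensor_product K U V) W (pure_tensor K U V u v) w) =
        pure_tensor K U (tensor_product K V W) u (pure_tensor K V W v w)"
proof -
  let ?UV = "tensor_product K U V" and ?VW = "tensor_product K V W"
  let ?T = "tensor_product K U ?VW"
  let ?b = "\<lambda>w u v. pure_tensor K U ?VW u (pure_tensor K V W v w)"
  note mUV = module_tensor_product[OF assms(1,2,3)]
  note mVW = module_tensor_product[OF assms(1,3,4)]
  note mT = module_tensor_product[OF assms(1,2) mVW]
  note pVW = bilinear_map_pure_tensor[OF assms(1,3,4)]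
  note pT = bilinear_map_pure_tensor[OF assms(1,2) mVW]
  note pUV = bilinear_map_pure_tensor[OF assms(1,2,3)]
  have b: "bilinear_map K U V ?T (?b w)" if "w \<in> carrier W" for w
    by (rule bilinear_map_compose[OF pT linear_map_id bilinear_map_left[OF pVW that]])
  have "bilinear_map K ?UV W ?T (\<lambda>t w. tensor_lift K U V ?T (?b w) t)"
  proof (rule bilinear_mapI)
    show "linear_map K ?UV ?T (tensor_lift K U V ?T (?b w))" if "w \<in> carrier W" for w
      by (rule linear_map_tensor_lift[OF assms(1-3) mT b[OF that]])
    show "linear_map K W ?T (\<lambda>w. tensor_lift K U V ?T (?b w) t)" if "t \<in> carrier ?UV" for t
    proof (rule linear_map_tensor_lift_parameter[OF assms(1-3) mT b _ assms(4) that])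
      show "linear_map K W ?T (\<lambda>w. ?b w u v)" if "u \<in> carrier U" "v \<in> carrier V" for u v
        by (rule linear_map_compose[OF bilinear_map_right[OF pT that(1)]
              bilinear_map_right[OF pVW that(2)]])
    qed
  qed
  note * = linear_map_tensor_lift[OF assms(1) mUV assms(4) mT this]
    tensor_lift_pure[OF assms(1) mUV assms(4) mT this]
  show "linear_map K (tensor_product K ?UV W) ?T (tensor_assoc K U V W)"
    unfolding tensor_assoc_def Let_def by (rule *)
  show "tensor_assoc K U V W (pure_tensor K ?UV W (pure_tensor K U V u v) w) =
        pure_tensor K U ?VW u (pure_tensor K V W v w)"
    if "u \<in> carrier U" "v \<in> carrier V" "w \<in> carrier W" for u v w
    using that bilinear_map_closed[OF pUV]
    by (simp add: tensor_assoc_def Let_def *(2) tensor_lift_pure[OF assms(1-3) mT b])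
qed

lemma tensor_assoc_inv_properties:
  assumes "field K" "module K U" "module K V" "module K W"
  shows linear_map_tensor_assoc_inv:
      "linear_map K (tensor_product K U (tensor_product K V W))
        (tensor_product K (tensor_product K U V) W) (tensor_assoc_inv K U V W)"
    and tensor_assoc_inv_pure: "\<And>u v w. u \<in> carrier U \<Longrightarrow> v \<in> carrier V \<Longrightarrow> w \<in> carrier W \<Longrightarrow>
      tensor_assoc_inv K U V W (pure_tensor K U (tensor_product K V W) u (pure_tensor K V W v w)) =
        pure_tensor K (tensor_product K U V) W (pure_tensor K U V u v) w"
proof -
  let ?UV = "tensor_product K U V" and ?VW = "tensor_product K V W"
  let ?T = "tensor_product K ?UV W"
  let ?b = "\<lambda>u v w. pure_tensor K ?UV W (pure_tensor K U V u v) w"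
  note mUV = module_tensor_product[OF assms(1,2,3)]
  note mVW = module_tensor_product[OF assms(1,3,4)]
  note mT = module_tensor_product[OF assms(1) mUV assms(4)]
  note pVW = bilinear_map_pure_tensor[OF assms(1,3,4)]
  note pT = bilinear_map_pure_tensor[OF assms(1) mUV assms(4)]
  note pUV = bilinear_map_pure_tensor[OF assms(1,2,3)]
  have b: "bilinear_map K V W ?T (?b u)" if "u \<in> carrier U" for u
    by (rule bilinear_map_compose[OF pT bilinear_map_right[OF pUV that] linear_map_id])
  have "bilinear_map K U ?VW ?T (\<lambda>u t. tensor_lift K V W ?T (?b u) t)"
  proof (rule bilinear_mapI)
    show "linear_map K ?VW ?T (tensor_lift K V W ?T (?b u))" if "u \<in> carrier U" for u
      by (rule linear_map_tensor_lift[OF assms(1,3,4) mT b[OF that]])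
    show "linear_map K U ?T (\<lambda>u. tensor_lift K V W ?T (?b u) t)" if "t \<in> carrier ?VW" for t
    proof (rule linear_map_tensor_lift_parameter[OF assms(1,3,4) mT b _ assms(2) that])
      show "linear_map K U ?T (\<lambda>u. ?b u v w)" if "v \<in> carrier V" "w \<in> carrier W" for v w
        by (rule linear_map_compose[OF bilinear_map_left[OF pT that(2)]
              bilinear_map_left[OF pUV that(1)]])
    qed
  qed
  note * = linear_map_tensor_lift[OF assms(1,2) mVW mT this]
    tensor_lift_pure[OF assms(1,2) mVW mT this]
  show "linear_map K (tensor_product K U ?VW) ?T (tensor_assoc_inv K U V W)"
    unfolding tensor_assoc_inv_def Let_def by (rule *)
  show "tensor_assoc_inv K U V W (pure_tensor K U ?VW u (pure_tensor K V W v w)) =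
        pure_tensor K ?UV W (pure_tensor K U V u v) w"
    if "u \<in> carrier U" "v \<in> carrier V" "w \<in> carrier W" for u v w
    using that bilinear_map_closed[OF pVW]
    by (simp add: tensor_assoc_inv_def Let_def *(2) tensor_lift_pure[OF assms(1,3,4) mT b])
qed

text \<open>Fixing one factor at a time: the \<open>v\<close> with \<open>v \<otimes> w\<close> in a given submodule form a submodule themselves.\<close>

lemma tensor_product_finitely_spanned:
  assumes "field K" "module K V" "module K W"
    and "S \<subseteq> carrier V" "lin_span K V S = carrier V"
    and "T \<subseteq> carrier W" "lin_span K W T = carrier W"
  shows "lin_span K (tensor_product K V W) ((\<lambda>(v, w). pure_tensor K V W v w) ` (S \<times> T)) =
    carrier (tensor_product K V W)"
proof
  let ?VW = "tensor_product K V W" and ?P = "(\<lambda>(v, w). pure_tensor K V W v w) ` (S \<times> T)"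
  note m = module_tensor_product[OF assms(1-3)]
  note p = bilinear_map_pure_tensor[OF assms(1-3)]
  have P: "?P \<subseteq> carrier ?VW" using bilinear_map_closed[OF p] assms(4,6) by auto
  show "lin_span K ?VW ?P \<subseteq> carrier ?VW" by (rule lin_span_subset_carrier[OF m P])
  let ?N = "lin_span K ?VW ?P"
  note N = submodule_lin_span[OF m P]
  have 1: "pure_tensor K V W v w \<in> ?N" if v: "v \<in> carrier V" and w: "w \<in> T" for v w
  proof -
    have wW: "w \<in> carrier W" using w assms(6) by blast
    have "S \<subseteq> {v \<in> carrier V. pure_tensor K V W v w \<in> ?N}"
      using w assms(4) lin_span_superset[of ?P K ?VW] by auto
    then have "lin_span K V S \<subseteq> {v \<in> carrier V. pure_tensor K V W v w \<in> ?N}"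
      by (rule lin_span_least[OF submodule_vimage[OF assms(2) m bilinear_map_left[OF p wW] N]])
    then show ?thesis using v assms(5) by auto
  qed
  have 2: "pure_tensor K V W v w \<in> ?N" if v: "v \<in> carrier V" and w: "w \<in> carrier W" for v w
  proof -
    have "T \<subseteq> {w \<in> carrier W. pure_tensor K V W v w \<in> ?N}"
      using 1 v assms(6) by auto
    then have "lin_span K W T \<subseteq> {w \<in> carrier W. pure_tensor K V W v w \<in> ?N}"
      by (rule lin_span_least[OF submodule_vimage[OF assms(3) m bilinear_map_right[OF p v] N]])
    then show ?thesis using w assms(7) by auto
  qed
  show "carrier ?VW \<subseteq> ?N" by (rule tensor_subset_submodule[OF assms(1-3) N 2])
qed

section \<open>Spaces of linear maps\<close>

lemma restrict_in_lin_hom: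
  assumes "module K V" "linear_map K V W f"
  shows "restrict f (carrier V) \<in> lin_hom K V W"
proof -
  interpret V: module K V by fact
  show ?thesis using assms(2) by (auto simp: lin_hom_def linear_map_def)
qed

lemma hom_space_simps:
  "carrier (hom_space K V W) = lin_hom K V W"
  "zero (hom_space K V W) = (\<lambda>x\<in>carrier V. \<zero>\<^bsub>W\<^esub>)"
  "add (hom_space K V W) = (\<lambda>f g. \<lambda>x\<in>carrier V. f x \<oplus>\<^bsub>W\<^esub> g x)"
  "smult (hom_space K V W) = (\<lambda>c f. \<lambda>x\<in>carrier V. c \<odot>\<^bsub>W\<^esub> f x)"
  by (simp_all add: hom_space_def)

lemma module_hom_space:
  assumes "module K V" "module K W"
  shows "module K (hom_space K V W)"
proof -
  interpret V: module K V by fact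
  interpret W: module K W by fact
  let ?H = "hom_space K V W"
  have lin: "linear_map K V W f" if "f \<in> carrier ?H" for f
    using that by (simp add: hom_space_simps linear_map_if_lin_hom)
  have closed: "f x \<in> carrier W" if "f \<in> carrier ?H" "x \<in> carrier V" for f x
    using lin that linear_map_closed by metis
  have add: "f \<oplus>\<^bsub>?H\<^esub> g \<in> carrier ?H" if "f \<in> carrier ?H" "g \<in> carrier ?H" for f g
    using restrict_in_lin_hom[OF assms(1) linear_map_sum[OF assms lin lin], OF that]
    by (simp add: hom_space_simps)
  have scale: "c \<odot>\<^bsub>?H\<^esub> f \<in> carrier ?H" if "c \<in> carrier K" "f \<in> carrier ?H" for c f
    using restrict_in_lin_hom[OF assms(1) linear_map_scale[OF assms lin], OF that(2,1)]
    by (simp add: hom_space_simps)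
  have "linear_map K V W (\<lambda>x. \<zero>\<^bsub>W\<^esub>)" by (intro linear_mapI) auto
  then have zero: "\<zero>\<^bsub>?H\<^esub> \<in> carrier ?H"
    using restrict_in_lin_hom[OF assms(1)] by (simp add: hom_space_simps)
  have eqI: "f = g" if "f \<in> carrier ?H" "g \<in> carrier ?H" "\<And>x. x \<in> carrier V \<Longrightarrow> f x = g x" for f g
    using that by (intro lin_hom_eqI[of f K V W g]) (simp_all add: hom_space_simps)
  note app = hom_space_simps(2-)
  show ?thesis
  proof (intro moduleI abelian_groupI)
    show "cring K" by (rule V.R.is_cring)
    show "\<exists>g\<in>carrier ?H. g \<oplus>\<^bsub>?H\<^esub> f = \<zero>\<^bsub>?H\<^esub>" if f: "f \<in> carrier ?H" for f
    proof
      show n: "(\<ominus>\<^bsub>K\<^esub> \<one>\<^bsub>K\<^esub>) \<odot>\<^bsub>?H\<^esub> f \<in> carrier ?H" using f by (intro scale) auto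
      show "(\<ominus>\<^bsub>K\<^esub> \<one>\<^bsub>K\<^esub>) \<odot>\<^bsub>?H\<^esub> f \<oplus>\<^bsub>?H\<^esub> f = \<zero>\<^bsub>?H\<^esub>"
        by (rule eqI[OF add[OF n f] zero])
          (use closed[OF f] in \<open>simp add: app a_inv_eq_smult[OF assms(2), symmetric] W.l_neg\<close>)
    qed
  qed (use closed in \<open>(intro add scale zero eqI; assumption?; simp add: app W.add.m_ac
      W.smult_l_distr W.smult_r_distr W.smult_assoc1)+\<close>)
qed

section \<open>Nearly Frobenius coproducts\<close>

lemma bilinear_map_postcompose:
  assumes "bilinear_map K V W U b" "linear_map K U U' f"
  shows "bilinear_map K V W U' (\<lambda>v w. f (b v w))"
  by (intro bilinear_mapI linear_map_compose[OF assms(2)] bilinear_map_left[OF assms(1)]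
      bilinear_map_right[OF assms(1)])

context k_algebra
begin

abbreviation "AA \<equiv> tensor_product R M M"
abbreviation pure (infixl "\<box>" 75) where "x \<box> y \<equiv> pure_tensor R M M x y"

text \<open>The outer actions of \<open>A\<close> on \<open>A \<otimes> A\<close>, as the maps \<open>(1 \<otimes> m) \<circ> assoc\<close> and \<open>(m \<otimes> 1) \<circ> assoc\<^sup>-\<^sup>1\<close> that
occur in the compatibility conditions of a coproduct. The formulas \<open>(x \<otimes> y) b = x \<otimes> y b\<close> and
\<open>a (x \<otimes> y) = a x \<otimes> y\<close> are \<open>right_action_pure\<close> and \<open>left_action_pure\<close>.\<close>

definition right_action :: "('a, ('a, 'c, 'c) tensor, 'c) tensor \<Rightarrow> ('a, 'c, 'c) tensor"
  where "right_action t =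
    tensor_map R M AA M M (\<lambda>a. a) (mult_map R M) (tensor_assoc R M M M t)"

definition left_action :: "('a, 'c, ('a, 'c, 'c) tensor) tensor \<Rightarrow> ('a, 'c, 'c) tensor"
  where "left_action t =
    tensor_map R AA M M M (mult_map R M) (\<lambda>a. a) (tensor_assoc_inv R M M M t)"

lemmas is_field = R.field_axioms
lemmas is_module = module_axioms
lemmas module_AA = module_tensor_product[OF is_field is_module is_module]
lemmas bilinear_pure = bilinear_map_pure_tensor[OF is_field is_module is_module]

lemma bilinear_mult: "bilinear_map R M M M (\<lambda>a b. a \<otimes>\<^bsub>M\<^esub> b)"
  by (intro bilinear_mapI linear_mapI)
    (simp_all add: M.l_distr M.r_distr smult_mult_left smult_mult_right)

lemma linear_mult_map: "linear_map R AA M (mult_map R M)"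
  unfolding mult_map_def
  by (rule linear_map_tensor_lift[OF is_field is_module is_module is_module bilinear_mult])

lemma mult_map_pure: "a \<in> carrier M \<Longrightarrow> b \<in> carrier M \<Longrightarrow> mult_map R M (a \<box> b) = a \<otimes>\<^bsub>M\<^esub> b"
  unfolding mult_map_def
  by (rule tensor_lift_pure[OF is_field is_module is_module is_module bilinear_mult])

lemma linear_right_action: "linear_map R (tensor_product R AA M) AA right_action"
  unfolding right_action_def
  by (rule linear_map_compose
      [OF linear_map_tensor_map[OF is_field is_module module_AA is_module is_module
          linear_map_id linear_mult_map]
        linear_map_tensor_assoc[OF is_field is_module is_module is_module]])

lemma linear_left_action: "linear_map R (tensor_product R M AA) AA left_action"
  unfolding left_action_def
  by (rule linear_map_compose
      [OF linear_map_tensor_map[OF is_field module_AA is_module is_module is_module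
          linear_mult_map linear_map_id]
        linear_map_tensor_assoc_inv[OF is_field is_module is_module is_module]])

lemma pure_closed: "x \<in> carrier M \<Longrightarrow> y \<in> carrier M \<Longrightarrow> x \<box> y \<in> carrier AA"
  by (rule bilinear_map_closed[OF bilinear_pure])

lemma right_action_pure:
  assumes "x \<in> carrier M" "y \<in> carrier M" "b \<in> carrier M"
  shows "right_action (pure_tensor R AA M (x \<box> y) b) = x \<box> (y \<otimes>\<^bsub>M\<^esub> b)"
  using assms
  by (simp add: right_action_def tensor_assoc_pure[OF is_field is_module is_module is_module]
      tensor_map_pure[OF is_field is_module module_AA is_module is_module
          linear_map_id linear_mult_map] pure_closed mult_map_pure)

lemma left_action_pure:
  assumes "a \<in> carrier M" "x \<in> carrier M" "y \<in> carrier M"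
  shows "left_action (pure_tensor R M AA a (x \<box> y)) = (a \<otimes>\<^bsub>M\<^esub> x) \<box> y"
  using assms
  by (simp add: left_action_def tensor_assoc_inv_pure[OF is_field is_module is_module is_module]
      tensor_map_pure[OF is_field module_AA is_module is_module is_module
          linear_mult_map linear_map_id] pure_closed mult_map_pure)

lemmas bilinear_right_action = bilinear_map_postcompose
  [OF bilinear_map_pure_tensor[OF is_field module_AA is_module] linear_right_action]

lemmas bilinear_left_action = bilinear_map_postcompose
  [OF bilinear_map_pure_tensor[OF is_field is_module module_AA] linear_left_action]

definition bimodule_map :: "('c \<Rightarrow> ('a, 'c, 'c) tensor) \<Rightarrow> bool"
  where "bimodule_map \<Delta> \<longleftrightarrow> (\<forall>a\<in>carrier M. \<forall>b\<in>carrier M.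
    \<Delta> (a \<otimes>\<^bsub>M\<^esub> b) = right_action (pure_tensor R AA M (\<Delta> a) b) \<and>
    \<Delta> (a \<otimes>\<^bsub>M\<^esub> b) = left_action (pure_tensor R M AA a (\<Delta> b)))"

lemma bimodule_mapI:
  assumes "\<And>a b. a \<in> carrier M \<Longrightarrow> b \<in> carrier M \<Longrightarrow>
      \<Delta> (a \<otimes>\<^bsub>M\<^esub> b) = right_action (pure_tensor R AA M (\<Delta> a) b)"
    and "\<And>a b. a \<in> carrier M \<Longrightarrow> b \<in> carrier M \<Longrightarrow>
      \<Delta> (a \<otimes>\<^bsub>M\<^esub> b) = left_action (pure_tensor R M AA a (\<Delta> b))"
  shows "bimodule_map \<Delta>"
  using assms unfolding bimodule_map_def by blast

lemma bimodule_mapD: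
  assumes "bimodule_map \<Delta>" "a \<in> carrier M" "b \<in> carrier M"
  shows bimodule_map_right: "\<Delta> (a \<otimes>\<^bsub>M\<^esub> b) = right_action (pure_tensor R AA M (\<Delta> a) b)"
    and bimodule_map_left: "\<Delta> (a \<otimes>\<^bsub>M\<^esub> b) = left_action (pure_tensor R M AA a (\<Delta> b))"
  using assms unfolding bimodule_map_def by blast+

text \<open>The compatibility conditions are identities of linear maps on \<open>A \<otimes> A\<close>, hence it suffices to state
them on pure tensors \<open>a \<otimes> b\<close>.\<close>

lemma bimodule_map_iff:
  assumes \<Delta>: "linear_map R M AA \<Delta>"
  shows "bimodule_map \<Delta> \<longleftrightarrow> (\<forall>t\<in>carrier AA.
    \<Delta> (mult_map R M t) = right_action (tensor_map R M M AA M \<Delta> (\<lambda>a. a) t) \<and>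
    \<Delta> (mult_map R M t) = left_action (tensor_map R M M M AA (\<lambda>a. a) \<Delta> t))"
    (is "_ \<longleftrightarrow> ?rhs")
proof -
  note T1 = tensor_map_properties
    [OF is_field is_module is_module module_AA is_module \<Delta> linear_map_id]
  note T2 = tensor_map_properties
    [OF is_field is_module is_module is_module module_AA linear_map_id \<Delta>]
  note ext = tensor_ext[OF is_field is_module is_module module_AA]
  note simps = T1(2) T2(2) mult_map_pure
  show ?thesis
  proof
    assume B: "bimodule_map \<Delta>"
    show ?rhs
    proof (intro ballI conjI)
      fix t assume t: "t \<in> carrier AA"
      show "\<Delta> (mult_map R M t) = right_action (tensor_map R M M AA M \<Delta> (\<lambda>a. a) t)"
        by (rule ext[OF linear_map_compose[OF \<Delta> linear_mult_map]
              linear_map_compose[OF linear_right_action T1(1)] _ t])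
          (simp add: simps bimodule_map_right[OF B])
      show "\<Delta> (mult_map R M t) = left_action (tensor_map R M M M AA (\<lambda>a. a) \<Delta> t)"
        by (rule ext[OF linear_map_compose[OF \<Delta> linear_mult_map]
              linear_map_compose[OF linear_left_action T2(1)] _ t])
          (simp add: simps bimodule_map_left[OF B])
    qed
  next
    assume rhs: ?rhs
    show "bimodule_map \<Delta>"
    proof (rule bimodule_mapI)
      fix a b assume ab: "a \<in> carrier M" "b \<in> carrier M"
      note * = rhs[rule_format, OF pure_closed[OF ab]]
      show "\<Delta> (a \<otimes>\<^bsub>M\<^esub> b) = right_action (pure_tensor R AA M (\<Delta> a) b)"
        using *[THEN conjunct1] ab by (simp add: simps)
      show "\<Delta> (a \<otimes>\<^bsub>M\<^esub> b) = left_action (pure_tensor R M AA a (\<Delta> b))"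
        using *[THEN conjunct2] ab by (simp add: simps)
    qed
  qed
qed

text \<open>Both sides equal \<open>G (\<Delta> 1) (\<Delta> a)\<close> for the bilinear map \<open>G\<close> with
\<open>G (p \<otimes> q) (x \<otimes> y) = p \<otimes> (q x \<otimes> y)\<close>.\<close>

lemma coassociative_if_bimodule_map:
  assumes \<Delta>: "linear_map R M AA \<Delta>" and B: "bimodule_map \<Delta>" and a: "a \<in> carrier M"
  shows "tensor_assoc R M M M (tensor_map R M M AA M \<Delta> (\<lambda>a. a) (\<Delta> a)) =
    tensor_map R M M M AA (\<lambda>a. a) \<Delta> (\<Delta> a)"
proof -
  let ?AAA = "tensor_product R M AA"
  \<comment> \<open>\<open>G (p \<otimes> q) v = p \<otimes> q v\<close>, built from structure maps so that bilinearity is inherited\<close>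
  let ?G = "\<lambda>u v. tensor_map R M ?AAA M AA (\<lambda>a. a) left_action
    (tensor_assoc R M M AA (pure_tensor R AA AA u v))"
  note module_AAA = module_tensor_product[OF is_field is_module module_AA]
  note T1 = tensor_map_properties
    [OF is_field is_module is_module module_AA is_module \<Delta> linear_map_id]
  note T2 = tensor_map_properties
    [OF is_field is_module is_module is_module module_AA linear_map_id \<Delta>]
  note TL = tensor_map_properties
    [OF is_field is_module module_AAA is_module module_AA linear_map_id linear_left_action]
  note assoc = tensor_assoc_properties[OF is_field is_module is_module is_module]
  note assoc' = tensor_assoc_properties[OF is_field is_module is_module module_AA]
  note p' = bilinear_map_pure_tensor[OF is_field is_module module_AA]
  note p'' = bilinear_map_pure_tensor[OF is_field module_AA is_module]
  note ext = tensor_ext[OF is_field is_module is_module module_AAA]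
  have G: "bilinear_map R AA AA ?AAA ?G"
    by (rule bilinear_map_postcompose[OF bilinear_map_pure_tensor[OF is_field module_AA module_AA]
          linear_map_compose[OF TL(1) assoc'(1)]])
  have G_pure: "?G (p \<box> q) v = pure_tensor R M AA p (left_action (pure_tensor R M AA q v))"
    if "p \<in> carrier M" "q \<in> carrier M" "v \<in> carrier AA" for p q v
    using that by (simp add: assoc'(2) TL(2) bilinear_map_closed[OF p'])
  define u where "u = \<Delta> \<one>\<^bsub>M\<^esub>"
  have u: "u \<in> carrier AA" unfolding u_def by (rule linear_map_closed[OF \<Delta>]) simp
  have \<Delta>_closed: "\<Delta> x \<in> carrier AA" if "x \<in> carrier M" for x
    using linear_map_closed[OF \<Delta> that] .
  have \<Delta>_eq: "\<Delta> x = right_action (pure_tensor R AA M u x)" if "x \<in> carrier M" for x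
    using bimodule_map_right[OF B M.one_closed that] that by (simp add: u_def)
  \<comment> \<open>comparing on \<open>s = p \<otimes> q\<close>, both sides are \<open>p \<otimes> (q x \<otimes> y)\<close>\<close>
  have 1: "tensor_assoc R M M M (pure_tensor R AA M (right_action (pure_tensor R AA M s x)) y) =
      ?G s (x \<box> y)" if "s \<in> carrier AA" "x \<in> carrier M" "y \<in> carrier M" for s x y
    by (rule ext[OF linear_map_compose[OF assoc(1) linear_map_compose[OF
            bilinear_map_left[OF p'' that(3)] bilinear_map_left[OF bilinear_right_action that(2)]]]
          bilinear_map_left[OF G pure_closed[OF that(2,3)]] _ that(1)])
      (use that in \<open>simp add: G_pure right_action_pure left_action_pure pure_closed assoc(2)\<close>)
  \<comment> \<open>uses \<open>\<Delta> x = (\<Delta> 1) x\<close> for the left factor of \<open>v = x \<otimes> y\<close>\<close>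
  have 2: "tensor_assoc R M M M (tensor_map R M M AA M \<Delta> (\<lambda>a. a) v) = ?G u v"
    if "v \<in> carrier AA" for v
    by (rule ext[OF linear_map_compose[OF assoc(1) T1(1)] bilinear_map_right[OF G u] _ that])
      (simp add: T1(2) 1[OF u, symmetric] \<Delta>_eq)
  \<comment> \<open>comparing on \<open>s = p \<otimes> q\<close>, both sides are \<open>p \<otimes> \<Delta> (q a)\<close>\<close>
  have 3: "tensor_map R M M M AA (\<lambda>a. a) \<Delta> (right_action (pure_tensor R AA M s a)) = ?G s (\<Delta> a)"
    if "s \<in> carrier AA" for s
    by (rule ext[OF linear_map_compose[OF T2(1) bilinear_map_left[OF bilinear_right_action a]]
          bilinear_map_left[OF G \<Delta>_closed[OF a]] _ that])
      (simp add: a G_pure right_action_pure T2(2) \<Delta>_closed bimodule_map_left[OF B])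
  show ?thesis
    using 2[OF \<Delta>_closed[OF a]] 3[OF u] \<Delta>_eq[OF a] by simp
qed

text \<open>Coassociativity follows from the other conditions, so that only conditions that are linear in
  \<open>\<Delta>\<close> remain.\<close>

lemma nearly_frobenius_coproduct_iff:
  "nearly_frobenius_coproduct R M \<Delta> \<longleftrightarrow> \<Delta> \<in> lin_hom R M AA \<and> bimodule_map \<Delta>"
  using bimodule_map_iff[of \<Delta>] coassociative_if_bimodule_map[of \<Delta>] linear_map_if_lin_hom[of \<Delta>]
  unfolding nearly_frobenius_coproduct_def Let_def right_action_def left_action_def by blast

text \<open>The bimodule property is linear in \<open>\<Delta>\<close>, unlike coassociativity, which it implies.\<close>

lemma submodule_coproducts:
  "submodule {\<Delta>. nearly_frobenius_coproduct R M \<Delta>} R (hom_space R M AA)"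
proof -
  let ?H = "hom_space R M AA"
  interpret AA: module R AA by (rule module_AA)
  interpret H: module R ?H by (rule module_hom_space[OF is_module module_AA])
  note app = hom_space_simps(2-)
  note r = bilinear_map_left[OF bilinear_right_action]
  note l = bilinear_map_right[OF bilinear_left_action]
  have closed: "\<Delta> x \<in> carrier AA" if "\<Delta> \<in> carrier ?H" "x \<in> carrier M" for \<Delta> x
    using that linear_map_closed[OF linear_map_if_lin_hom] by (metis hom_space_simps(1))
  show ?thesis
  proof (rule submodule_if_closed[OF H.module_axioms];
      unfold nearly_frobenius_coproduct_iff hom_space_simps(1)[symmetric] mem_Collect_eq)
    have "bimodule_map \<zero>\<^bsub>?H\<^esub>"
      by (rule bimodule_mapI) (simp_all add: app linear_map_zero[OF module_AA module_AA r]
          linear_map_zero[OF module_AA module_AA l])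
    then show "\<zero>\<^bsub>?H\<^esub> \<in> carrier ?H \<and> bimodule_map \<zero>\<^bsub>?H\<^esub>" by blast
  next
    fix \<Delta> \<Delta>' assume *: "\<Delta> \<in> carrier ?H \<and> bimodule_map \<Delta>" "\<Delta>' \<in> carrier ?H \<and> bimodule_map \<Delta>'"
    then have c: "\<Delta> \<in> carrier ?H" "\<Delta>' \<in> carrier ?H" and b: "bimodule_map \<Delta>" "bimodule_map \<Delta>'"
      by auto
    have "bimodule_map (\<Delta> \<oplus>\<^bsub>?H\<^esub> \<Delta>')"
    proof (rule bimodule_mapI)
      fix x y assume xy: "x \<in> carrier M" "y \<in> carrier M"
      show "(\<Delta> \<oplus>\<^bsub>?H\<^esub> \<Delta>') (x \<otimes>\<^bsub>M\<^esub> y) =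
          right_action (pure_tensor R AA M ((\<Delta> \<oplus>\<^bsub>?H\<^esub> \<Delta>') x) y)"
        using xy c by (simp add: app linear_map_add[OF r] closed b[THEN bimodule_map_right])
      show "(\<Delta> \<oplus>\<^bsub>?H\<^esub> \<Delta>') (x \<otimes>\<^bsub>M\<^esub> y) =
          left_action (pure_tensor R M AA x ((\<Delta> \<oplus>\<^bsub>?H\<^esub> \<Delta>') y))"
        using xy c by (simp add: app linear_map_add[OF l] closed b[THEN bimodule_map_left])
    qed
    then show "\<Delta> \<oplus>\<^bsub>?H\<^esub> \<Delta>' \<in> carrier ?H \<and> bimodule_map (\<Delta> \<oplus>\<^bsub>?H\<^esub> \<Delta>')"
      using c by simp
  next
    fix c \<Delta> assume c: "c \<in> carrier R" and "\<Delta> \<in> carrier ?H \<and> bimodule_map \<Delta>"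
    then have d: "\<Delta> \<in> carrier ?H" and b: "bimodule_map \<Delta>"
      by auto
    have "bimodule_map (c \<odot>\<^bsub>?H\<^esub> \<Delta>)"
    proof (rule bimodule_mapI)
      fix x y assume xy: "x \<in> carrier M" "y \<in> carrier M"
      show "(c \<odot>\<^bsub>?H\<^esub> \<Delta>) (x \<otimes>\<^bsub>M\<^esub> y) = right_action (pure_tensor R AA M ((c \<odot>\<^bsub>?H\<^esub> \<Delta>) x) y)"
        using xy c d by (simp add: app linear_map_smult[OF r] closed b[THEN bimodule_map_right])
      show "(c \<odot>\<^bsub>?H\<^esub> \<Delta>) (x \<otimes>\<^bsub>M\<^esub> y) = left_action (pure_tensor R M AA x ((c \<odot>\<^bsub>?H\<^esub> \<Delta>) y))"
        using xy c d by (simp add: app linear_map_smult[OF l] closed b[THEN bimodule_map_left])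
    qed
    then show "c \<odot>\<^bsub>?H\<^esub> \<Delta> \<in> carrier ?H \<and> bimodule_map (c \<odot>\<^bsub>?H\<^esub> \<Delta>)"
      using c d by simp
  qed blast
qed

text \<open>The evaluation \<open>\<Delta> \<mapsto> \<Delta> 1\<close> embeds the Frobenius space into \<open>A \<otimes> A\<close>, because \<open>\<Delta> x = x (\<Delta> 1)\<close>.\<close>

lemma Frobdim_finite_if_finite_dimensional:
  assumes "vdim R M \<noteq> \<infinity>"
  shows "Frobdim R M \<noteq> \<infinity>"
proof -
  obtain B where B: "finite B" "B \<subseteq> carrier M" "lin_span R M B = carrier M"
    using assms unfolding vdim_finite_iff is_basis_def by blast
  let ?S = "(\<lambda>(v, w). v \<box> w) ` (B \<times> B)"
  let ?E = "frobenius_space R M"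
  interpret AA: module R AA by (rule module_AA)
  have E: "module R ?E"
    unfolding frobenius_space_def
    by (rule submodule.submodule_is_module[OF submodule_coproducts
          module_hom_space[OF is_module module_AA]])
  have app: "carrier ?E = {\<Delta>. nearly_frobenius_coproduct R M \<Delta>}"
    "\<zero>\<^bsub>?E\<^esub> = (\<lambda>x\<in>carrier M. \<zero>\<^bsub>AA\<^esub>)"
    "\<Delta> \<oplus>\<^bsub>?E\<^esub> \<Delta>' = (\<lambda>x\<in>carrier M. \<Delta> x \<oplus>\<^bsub>AA\<^esub> \<Delta>' x)"
    "c \<odot>\<^bsub>?E\<^esub> \<Delta> = (\<lambda>x\<in>carrier M. c \<odot>\<^bsub>AA\<^esub> \<Delta> x)" for \<Delta> \<Delta>' c
    by (simp_all add: frobenius_space_def hom_space_def)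
  have ev: "linear_map R ?E AA (\<lambda>\<Delta>. \<Delta> \<one>\<^bsub>M\<^esub>)"
    by (intro linear_mapI) (auto simp: app nearly_frobenius_coproduct_iff
        intro: linear_map_closed[OF linear_map_if_lin_hom])
  have inj: "\<Delta> = \<zero>\<^bsub>?E\<^esub>" if "\<Delta> \<in> carrier ?E" and 0: "\<Delta> \<one>\<^bsub>M\<^esub> = \<zero>\<^bsub>AA\<^esub>" for \<Delta>
  proof -
    have \<Delta>: "\<Delta> \<in> lin_hom R M AA" "bimodule_map \<Delta>"
      using that by (auto simp: app nearly_frobenius_coproduct_iff)
    have "\<Delta> x = \<zero>\<^bsub>AA\<^esub>" if x: "x \<in> carrier M" for x
    proof -
      have "\<Delta> (x \<otimes>\<^bsub>M\<^esub> \<one>\<^bsub>M\<^esub>) = left_action (pure_tensor R M AA x (\<Delta> \<one>\<^bsub>M\<^esub>))"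
        by (rule bimodule_map_left[OF \<Delta>(2) x M.one_closed])
      then show ?thesis
        using x by (simp add: 0 linear_map_zero[OF module_AA module_AA
              bilinear_map_right[OF bilinear_left_action x]])
    qed
    moreover have "\<Delta> \<in> extensional (carrier M)" using \<Delta>(1) by (simp add: lin_hom_def PiE_iff)
    ultimately show ?thesis unfolding app by (auto simp: extensional_def fun_eq_iff)
  qed
  show ?thesis
    unfolding Frobdim_def
  proof (rule vdim_finite_if_injective[OF is_field E module_AA ev inj])
    show "finite ?S" using B by simp
    show "?S \<subseteq> carrier AA" using B by (auto intro: pure_closed)
    show "lin_span R AA ?S = carrier AA"
      by (rule tensor_product_finitely_spanned[OF is_field is_module is_module B(2,3) B(2,3)])
  qed
qed

end

theorem corollary4p9:
  fixes K :: "'k ring" and A :: "('k, 'a) module" and Q :: "('v, 'e) pre_digraph"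
  assumes "field K"
    and "fin_digraph Q" and "Digraph_Component.connected Q" and "\<nexists>p. wf_digraph.closed_w Q p"
    and "gentle_algebra K A Q"
  shows "Frobdim K A < \<infinity>"
proof -
  have "k_algebra K A" "vdim K A \<noteq> \<infinity>"
    using assms(5) by (simp_all add: gentle_algebra_def)
  then have "Frobdim K A \<noteq> \<infinity>"
    by (rule k_algebra.Frobdim_finite_if_finite_dimensional)
  then show ?thesis by simp
qed

end
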